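(* Let $b\in\{2,3\}$ and let $\mathcal{L}_b$ be the equation $x+by=b^{2}z$. Let $$A_b=\{u\cdot b^{3i}: u>0,\ i\ge 0 \text{ integers},\ b\nmid u\}.$$ Then for every integer $n>0$ the set $A_b\cap[1,n]$ is an $\mathcal{L}_b$-avoiding subset of $[1,n]$ of maximum size. In particular $\lambda_{0,\mathcal{L}_b}=\rho_{\mathcal{L}_b}=\frac{b^2}{b^2+b+1}$.
   Context: $[1,n]$ denotes $\{1,\dots,n\}$. A set $A$ of positive integers is $\mathcal{L}$-avoiding if there are no $x,y,z\in A$ (not necessarily distinct) satisfying the equation $\mathcal{L}$. Let $r_{\mathcal{L}}(n)$ be the maximum size of an $\mathcal{L}$-avoiding subset of $[1,n]$, and $\lambda_{0,\mathcal{L}}=\limsup_{n\to\infty} r_{\mathcal{L}}(n)/n$. For each integer $m>0$ let $\rho_m\cdot m$ be the maximum size of a subset of $[1,m]$ which contains no solutions to $\mathcal{L}$ modulo $m$ (i.e. to the congruence modulo $m$ obtained from the equation), and let $\rho_{\mathcal{L}}=\sup_m\rho_m$. *)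

theory Defs
  imports Complex_Main "HOL-Library.Extended_Real" "HOL-Library.Liminf_Limsup" "HOL-Number_Theory.Cong"
begin

text \<open>\<open>Lin_Eq p q r\<close> stands for the equation \<open>p x + q y = r z\<close>. It is kept as syntax because both
  the equation itself and the congruences obtained from it are needed.\<close>

datatype lin_eq = Lin_Eq int int int

fun solution :: "lin_eq \<Rightarrow> nat \<Rightarrow> nat \<Rightarrow> nat \<Rightarrow> bool" where
  "solution (Lin_Eq p q r) x y z \<longleftrightarrow> p * int x + q * int y = r * int z"

fun solution_mod :: "nat \<Rightarrow> lin_eq \<Rightarrow> nat \<Rightarrow> nat \<Rightarrow> nat \<Rightarrow> bool" where
  "solution_mod m (Lin_Eq p q r) x y z \<longleftrightarrow> [p * int x + q * int y = r * int z] (mod int m)"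

definition avoiding :: "lin_eq \<Rightarrow> nat set \<Rightarrow> bool" where
  "avoiding L A \<longleftrightarrow> \<not> (\<exists>x\<in>A. \<exists>y\<in>A. \<exists>z\<in>A. solution L x y z)"

definition avoiding_mod :: "nat \<Rightarrow> lin_eq \<Rightarrow> nat set \<Rightarrow> bool" where
  "avoiding_mod m L A \<longleftrightarrow> \<not> (\<exists>x\<in>A. \<exists>y\<in>A. \<exists>z\<in>A. solution_mod m L x y z)"

definition max_avoiding :: "lin_eq \<Rightarrow> nat \<Rightarrow> nat" where
  "max_avoiding L n = Max {card A | A. A \<subseteq> {1..n} \<and> avoiding L A}"

text \<open>Limit superior and supremum are taken in \<^typ>\<open>ereal\<close>, where they always exist; the value of the
  sequence at \<open>n = 0\<close> is irrelevant for the limit superior.\<close>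

definition lambda0 :: "lin_eq \<Rightarrow> ereal" where
  "lambda0 L = limsup (\<lambda>n. ereal (real (max_avoiding L n) / real n))"

definition rho_mod :: "lin_eq \<Rightarrow> nat \<Rightarrow> real" where
  "rho_mod L m = real (Max {card A | A. A \<subseteq> {1..m} \<and> avoiding_mod m L A}) / real m"

definition rho :: "lin_eq \<Rightarrow> ereal" where
  "rho L = (SUP m\<in>{0<..}. ereal (rho_mod L m))"

definition eqn_b :: "nat \<Rightarrow> lin_eq" where
  "eqn_b b = Lin_Eq 1 (int b) (int b ^ 2)"

definition A_b :: "nat \<Rightarrow> nat set" where
  "A_b b = {u * b ^ (3 * i) | u i. u > 0 \<and> \<not> b dvd u}"

end

theory Submission
  imports Defs
begin

text \<open>Write an element of \<open>A_b b\<close> as \<open>u * b ^ (3 * i)\<close> with \<open>b\<close> not dividing \<open>u\<close>. In \<open>x + b y - b\<^sup>2 z\<close> with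
  \<open>x, y, z\<close> taken from \<open>A_b b\<close>, the three terms contain powers of \<open>b\<close> with exponents congruent to
  \<open>0\<close>, \<open>1\<close>, \<open>2\<close> modulo \<open>3\<close>. The smallest exponent occurs only once, so the sum is not \<open>0\<close>; it is not
  even \<open>0\<close> modulo \<open>b ^ (3 * j)\<close> when all three numbers are smaller than that modulus
  (\<open>not_dvd_combination_A_b\<close>).

  For the maximality of \<open>A_b b\<close>, split an avoiding set \<open>A \<subseteq> {1..n}\<close> into the elements that are not
  divisible by \<open>b ^ 3\<close> and the elements \<open>b ^ 3 * t\<close>. The equation is homogeneous, so the \<open>t\<close> form an
  avoiding subset of \<open>{1..n div b ^ 3}\<close>. The set \<open>A_b b\<close> splits in the same way, and its first part
  consists of all non-multiples of \<open>b\<close>. By induction it therefore suffices to show, for one layer,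
  that an avoiding set has at most as many elements outside the multiples of \<open>b ^ 3\<close> as there are
  non-multiples of \<open>b\<close> in \<open>{1..n}\<close>.

  For \<open>b = 2\<close> no two of \<open>2 t, 3 t, 4 t\<close> lie in \<open>A\<close> together, nor do \<open>t\<close> and \<open>2 t\<close>. This allows one
  to cover all numbers not divisible by \<open>8\<close> by cliques of pairwise incompatible numbers, each of
  them containing exactly one odd number (\<open>card_not_dvd_8_le\<close>).

  For \<open>b = 3\<close> one has to show that the elements \<open>3 s\<close> and \<open>9 r\<close> of \<open>A\<close> with \<open>r, s\<close> prime to \<open>3\<close> are
  at most as many as the non-multiples of \<open>3\<close> missing from \<open>A\<close>. Missing numbers come from three
  sources: \<open>3 z - s\<close> for \<open>z \<in> A\<close>, and \<open>r + s\<close>, and \<open>r + 3 r'\<close>. Each source has a fixed residue modulo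
  \<open>3\<close> in terms of the residues of \<open>r\<close> and \<open>s\<close>, so the residue classes can be treated separately.
  Let \<open>R\<close> and \<open>S\<close> be the sets of those \<open>r\<close> and \<open>s\<close> in one class. If both are nonempty, then \<open>R + S\<close>
  has at least \<open>|R| + |S| - 1\<close> elements, which is short of what is wanted by a single element, and
  that element can be found among the other sources (\<open>card_ninths_thirds_le_card_gaps\<close>). If \<open>R\<close> is
  empty, the reflections \<open>3 z - s\<close> suffice (\<open>card_thirds_le_card_gaps\<close>). If \<open>S\<close> is empty, \<open>R\<close> is
  balanced by the numbers \<open>r + 3 r'\<close>, or together with the \<open>s\<close> of the other class by non-members up to
  \<open>n / 3\<close> and reflections at the members up to \<open>n / 3\<close> (\<open>card_ninths_opposite_thirds_le\<close>).
  These arguments need \<open>n \<ge> 27\<close>; for smaller \<open>n\<close> explicit disjoint solutions are listed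
  (\<open>card_Int_le_of_le_26\<close>).

  The densities follow. The recursion for \<open>|A_b b \<inter> {1..n}|\<close> gives its asymptotic density, hence
  \<open>lambda0\<close>. A set without solutions modulo \<open>m\<close> extends periodically to an avoiding set, so \<open>rho\<close> is at
  most this density, and the sets \<open>A_b b \<inter> {1..<b ^ (3 * j)}\<close> show that it is at least as large.
\<close>

section \<open>Counting and residues modulo 3\<close>

lemma card_add_le_card_Un:
  assumes "finite X" "finite Y" "X \<inter> Y \<subseteq> {w}"
  shows "card X + card Y \<le> card (X \<union> Y) + 1"
proof -
  have "card (X \<inter> Y) \<le> 1" using card_mono[OF _ assms(3)] by simp
  then show ?thesis using card_Un_Int[OF assms(1,2)] by linarith
qed

text \<open>The chain behind \<open>|X + Y| \<ge> |X| + |Y| - 1\<close>: the two translates meet in a single point. The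
  explicit chain is kept, and not only the bound, because the case of equality is needed: a set of
  size \<open>|X| + |Y| - 1\<close> that contains the sumset must coincide with this chain.\<close>

lemma Min_translate_Un_translate_Max:
  fixes X Y :: "nat set"
  assumes "finite X" "finite Y" "X \<noteq> {}" "Y \<noteq> {}"
  shows "card X + card Y \<le> card ((+) (Min X) ` Y \<union> (\<lambda>x. x + Max Y) ` X) + 1"
proof -
  let ?U = "(+) (Min X) ` Y" and ?V = "(\<lambda>x. x + Max Y) ` X"
  have "?U \<inter> ?V \<subseteq> {Min X + Max Y}"
  proof
    fix w assume "w \<in> ?U \<inter> ?V"
    then obtain x y where "w = Min X + y" "w = x + Max Y" "y \<in> Y" "x \<in> X" by blast
    moreover from this have "y \<le> Max Y" "Min X \<le> x" using assms by auto
    ultimately show "w \<in> {Min X + Max Y}" by auto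
  qed
  moreover have "card ?U = card Y" "card ?V = card X" by (auto simp: card_image inj_on_def)
  ultimately show ?thesis using card_add_le_card_Un[of ?U ?V "Min X + Max Y"] assms by simp
qed

lemma ex_residue_3:
  fixes k e :: nat assumes "e < 3" "e \<le> k"
  shows "\<exists>c. c mod 3 = e \<and> c \<le> k \<and> k < c + 3"
proof -
  define q where "q = (k - e) div 3"
  have "3 * q \<le> k - e" "k - e < 3 * q + 3" by (auto simp: q_def)
  then have "(3 * q + e) mod 3 = e \<and> 3 * q + e \<le> k \<and> k < 3 * q + e + 3"
    using assms by auto
  then show ?thesis by blast
qed

lemma mod_3_E:
  fixes s e :: nat assumes "s mod 3 = e" obtains q where "s = 3 * q + e"
  using assms by (metis mult_div_mod_eq)

lemma mod_3_less:
  fixes c d e :: nat assumes "c mod 3 = e" "d mod 3 = e" "c < d"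
  shows "c + 3 \<le> d"
proof -
  obtain p where "c = 3 * p + e" using assms(1) by (rule mod_3_E)
  moreover obtain q where "d = 3 * q + e" using assms(2) by (rule mod_3_E)
  ultimately show ?thesis using assms(3) by simp
qed

lemma mod_3_reflect:
  fixes s z e :: nat assumes "s mod 3 = e" "e = 1 \<or> e = 2" "s < 3 * z"
  shows "(3 * z - s) mod 3 = 3 - e"
proof -
  obtain q where q: "s = 3 * q + e" using assms(1) by (rule mod_3_E)
  then have "q < z" using assms(3) by linarith
  then obtain k where "z = q + 1 + k" using less_iff_Suc_add by auto
  then have "3 * z - s = (3 - e) + 3 * k" using q assms(2) by linarith
  then show ?thesis using assms(2) by auto
qed

lemma mod_3_add:
  fixes r s e :: nat assumes "r mod 3 = e" "s mod 3 = e" "e = 1 \<or> e = 2"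
  shows "(r + s) mod 3 = 3 - e"
proof -
  obtain p where "r = 3 * p + e" using assms(1) by (rule mod_3_E)
  moreover obtain q where "s = 3 * q + e" using assms(2) by (rule mod_3_E)
  ultimately have "r + s = 2 * e + 3 * (p + q)" by simp
  then have "(r + s) mod 3 = (2 * e) mod 3" by (metis mod_mult_self2)
  then show ?thesis using assms(3) by auto
qed

lemma card_residue_3:
  assumes "e = 1 \<or> e = (2::nat)"
  shows "card {x \<in> {1..k}. x mod 3 = e} = (k + 3 - e) div 3"
proof (induction k)
  case 0
  then show ?case using assms by auto
next
  case (Suc k)
  have "{x \<in> {1..Suc k}. x mod 3 = e} =
      (if Suc k mod 3 = e then insert (Suc k) {x \<in> {1..k}. x mod 3 = e} else {x \<in> {1..k}. x mod 3 = e})"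
    by (auto simp: le_Suc_eq)
  then have "card {x \<in> {1..Suc k}. x mod 3 = e} = (k + 3 - e) div 3 + (if Suc k mod 3 = e then 1 else 0)"
    using Suc by simp
  also have "\<dots> = (Suc k + 3 - e) div 3"
  proof -
    have "Suc (k + 3 - e) mod 3 = 0 \<longleftrightarrow> Suc k mod 3 = e" using assms by presburger
    moreover have "Suc k + 3 - e = Suc (k + 3 - e)" using assms by auto
    ultimately show ?thesis by (simp add: div_Suc)
  qed
  finally show ?case .
qed

text \<open>The values that \<open>card_residue_3\<close> takes in the comparison of a class on \<open>{1..m}\<close> with the
  opposite class on \<open>{m<..3 * m}\<close>.\<close>

lemma residue_counts:
  fixes m :: nat assumes "3 \<le> m"
  shows "(m + 2) div 3 + 1 + (m + 1) div 3 \<le> m" "(3 * m + 1) div 3 = m" "(3 * m + 2) div 3 = m"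
proof -
  define p q where "p = (m + 2) div 3" and "q = (m + 1) div 3"
  have "3 * p \<le> m + 2" "3 * q \<le> m + 1" by (simp_all add: p_def q_def)
  then have "6 \<le> m \<Longrightarrow> p + 1 + q \<le> m" by linarith
  moreover have "p + 1 + q \<le> m" if "m < 6"
  proof -
    have "m = 3 \<or> m = 4 \<or> m = 5" using that assms by linarith
    then show ?thesis by (auto simp: p_def q_def)
  qed
  ultimately show "(m + 2) div 3 + 1 + (m + 1) div 3 \<le> m" unfolding p_def q_def by linarith
qed simp_all

lemma card_not_dvd:
  fixes b :: nat assumes "0 < b"
  shows "card {x \<in> {1..n}. \<not> b dvd x} = n - n div b"
proof -
  have "b * i \<le> n" if "i \<le> n div b" for i
    using that assms by (simp add: less_eq_div_iff_mult_less_eq mult.commute)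
  moreover have "i \<le> n div b" if "b * i \<le> n" for i
    using that assms by (simp add: less_eq_div_iff_mult_less_eq mult.commute)
  ultimately have "{x \<in> {1..n}. \<not> b dvd x} = {1..n} - (*) b ` {1..n div b}"
    and sub: "(*) b ` {1..n div b} \<subseteq> {1..n}"
    using assms by (auto elim!: dvdE simp: image_iff)
  moreover have "card ((*) b ` {1..n div b}) = n div b"
    using assms by (subst card_image) (auto simp: inj_on_def)
  ultimately show ?thesis using card_Diff_subset[OF _ sub] by simp
qed

lemma length_le_card_Diff:
  assumes "distinct (concat xss)" "\<forall>xs \<in> set xss. \<not> set xs \<subseteq> A"
  shows "length xss \<le> card (set (concat xss) - A)"
  using assms
proof (induction xss)
  case (Cons xs xss)
  have "set xs - A \<noteq> {}" using Cons.prems(2) by auto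
  then have "1 \<le> card (set xs - A)" by (simp add: Suc_le_eq card_gt_0_iff)
  moreover have "length xss \<le> card (set (concat xss) - A)" using Cons by simp
  moreover have "card (set (concat (xs # xss)) - A) = card (set xs - A) + card (set (concat xss) - A)"
    using Cons.prems(1) by (subst card_Un_disjoint[symmetric]) (auto intro!: arg_cong[where f = card])
  ultimately show ?case by simp
qed simp

text \<open>Every block of a disjoint family contributes at least one number outside \<open>A\<close>.\<close>

lemma card_Int_add_length_le:
  assumes "distinct (concat xss)" "set (concat xss) \<subseteq> {1..n}" "\<forall>xs \<in> set xss. \<not> set xs \<subseteq> A"
  shows "card (A \<inter> {1..n}) + length xss \<le> n"
proof -
  have "length xss \<le> card (set (concat xss) - A)" using length_le_card_Diff[OF assms(1,3)] .
  also have "\<dots> \<le> card ({1..n} - A)" using assms(2) by (intro card_mono) auto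
  finally have "length xss \<le> card ({1..n} - A)" .
  moreover have "card (A \<inter> {1..n}) + card ({1..n} - A) = n"
    using card_Diff_subset_Int[of "{1..n}" A] card_mono[of "{1..n}" "A \<inter> {1..n}"] by (simp add: Int_commute)
  ultimately show ?thesis by simp
qed

section \<open>One layer for the equation \<open>x + 3 y = 9 z\<close>\<close>

text \<open>Only the elements outside the multiples of \<open>27\<close> are to be counted. Apart from the non-multiples
  of \<open>3\<close> these are the numbers \<open>3 s\<close> and \<open>9 s\<close> with \<open>s\<close> prime to \<open>3\<close>, sorted below by the residue of
  \<open>s\<close>. Throughout, \<open>e\<close> is one of the residues \<open>1\<close> and \<open>2\<close>, and \<open>3 - e\<close> is the other one.\<close>

locale avoiding_3 =
  fixes n :: nat and A :: "nat set"
  assumes sub: "A \<subseteq> {1..n}"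
    and no: "\<lbrakk>x \<in> A; y \<in> A; z \<in> A\<rbrakk> \<Longrightarrow> x + 3 * y \<noteq> 9 * z"
begin

definition thirds :: "nat \<Rightarrow> nat set" where "thirds e = {s. 3 * s \<in> A \<and> s mod 3 = e}"
definition ninths :: "nat \<Rightarrow> nat set" where "ninths e = {s. 9 * s \<in> A \<and> s mod 3 = e}"
definition gaps :: "nat \<Rightarrow> nat set" where "gaps e = {x \<in> {1..n}. x mod 3 = e \<and> x \<notin> A}"

lemma bounds: "x \<in> A \<Longrightarrow> 1 \<le> x \<and> x \<le> n" using sub by auto

lemma thirds_bounds: "s \<in> thirds e \<Longrightarrow> 3 * s \<in> A \<and> s mod 3 = e \<and> 1 \<le> s \<and> 3 * s \<le> n"
  using bounds[of "3 * s"] by (auto simp: thirds_def)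

lemma ninths_bounds: "s \<in> ninths e \<Longrightarrow> 9 * s \<in> A \<and> s mod 3 = e \<and> 1 \<le> s \<and> 9 * s \<le> n"
  using bounds[of "9 * s"] by (auto simp: ninths_def)

lemma finites: "finite (thirds e)" "finite (ninths e)" "finite (gaps e)" "finite A"
proof -
  show "finite (thirds e)" by (rule finite_subset[of _ "{..n}"]) (auto dest: thirds_bounds)
  show "finite (ninths e)" by (rule finite_subset[of _ "{..n}"]) (auto dest: ninths_bounds)
  show "finite (gaps e)" by (auto simp: gaps_def)
  show "finite A" by (rule finite_subset[OF sub]) simp
qed

text \<open>From \<open>3 s + 3 (3 z - s) = 9 z\<close>.\<close>

lemma reflect_gap:
  assumes "z \<in> A" "s \<in> thirds e" "e = 1 \<or> e = 2" "s < 3 * z" "3 * z \<le> n + s"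
  shows "3 * z - s \<in> gaps (3 - e)"
proof -
  have "3 * z - s \<notin> A" using no[of "3 * s" "3 * z - s" z] thirds_bounds[OF assms(2)] assms by auto
  moreover have "(3 * z - s) mod 3 = 3 - e" using mod_3_reflect thirds_bounds[OF assms(2)] assms(3,4) by blast
  ultimately show ?thesis using assms by (auto simp: gaps_def)
qed

text \<open>From \<open>9 r + 3 (3 s) = 9 (r + s)\<close>.\<close>

lemma sum_gap:
  assumes "r \<in> ninths e" "s \<in> thirds e" "e = 1 \<or> e = 2"
  shows "r + s \<in> gaps (3 - e)"
proof -
  have "r + s \<notin> A" using no[of "9 * r" "3 * s" "r + s"] thirds_bounds[OF assms(2)] ninths_bounds[OF assms(1)] by auto
  moreover have "(r + s) mod 3 = 3 - e"
    using mod_3_add thirds_bounds[OF assms(2)] ninths_bounds[OF assms(1)] assms(3) by blast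
  ultimately show ?thesis using thirds_bounds[OF assms(2)] ninths_bounds[OF assms(1)] by (auto simp: gaps_def)
qed

text \<open>From \<open>9 r + 3 (9 t) = 9 (r + 3 t)\<close>.\<close>

lemma quadruple_gap:
  assumes "r \<in> ninths e" "9 * t \<in> A"
  shows "r + 3 * t \<in> gaps e"
proof -
  have "r + 3 * t \<notin> A" using no[of "9 * r" "9 * t" "r + 3 * t"] assms(2) ninths_bounds[OF assms(1)] by auto
  then show ?thesis using ninths_bounds[OF assms(1)] bounds[OF assms(2)] by (auto simp: gaps_def)
qed

text \<open>Let \<open>z\<close> be the largest element of \<open>A\<close> up to \<open>n / 3\<close>. Below \<open>3 z\<close> the reflection \<open>s \<mapsto> 3 z - s\<close> leads
  to non-members; above \<open>3 z\<close> every number up to \<open>n / 3\<close> is itself a non-member, so that a shift of \<open>s\<close>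
  by one into the opposite class works. The shift upwards can leave the range \<open>{..n div 3}\<close> and hit
  a member; that member then serves as the centre of reflection instead.\<close>

lemma card_thirds_le_card_gaps:
  assumes "9 \<le> n" and e: "e = 1 \<or> e = 2"
  shows "card (thirds e) \<le> card (gaps (3 - e))"
proof (cases "n div 3 mod 3 = 1 \<and> n div 3 + 1 \<in> A \<and> e = 1")
  case True
  define z where "z = n div 3 + 1"
  \<comment> \<open>The reflection of \<open>1\<close> at \<open>z\<close> may exceed \<open>n\<close>. If \<open>1\<close> is a third, then \<open>3 \<in> A\<close>, and the reflection
    of \<open>1\<close> at \<open>3\<close> is \<open>8\<close>, below all other images.\<close>
  let ?f = "\<lambda>s. if s = 1 then 8 else 3 * z - s"
  have zA: "z \<in> A" using True by (simp add: z_def)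
  have z: "3 * z \<le> n + 3" "n < 3 * z" "4 \<le> z" using assms(1) by (auto simp: z_def)
  have s: "s = 1 \<or> 4 \<le> s" if "s \<in> thirds e" for s
  proof -
    have "s mod 3 = 1" using thirds_bounds[OF that] True by simp
    then show ?thesis by presburger
  qed
  have im: "?f ` thirds e \<subseteq> gaps (3 - e)"
  proof clarify
    fix s assume s1: "s \<in> thirds e"
    show "?f s \<in> gaps (3 - e)"
    proof (cases "s = 1")
      case s: True
      then show ?thesis using reflect_gap[of 3 1 e] s1 True assms(1) thirds_bounds[OF s1] by simp
    next
      case False
      then show ?thesis using reflect_gap[OF zA s1 e] s[OF s1] z thirds_bounds[OF s1] by simp
    qed
  qed
  have "inj_on ?f (thirds e)"
  proof (rule inj_onI)
    fix s t assume st: "s \<in> thirds e" "t \<in> thirds e" "?f s = ?f t"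
    then have "3 * s \<le> n" "3 * t \<le> n" using thirds_bounds by auto
    then have "8 < 3 * z - s" "8 < 3 * z - t" "s < 3 * z" "t < 3 * z" using z by linarith+
    then show "s = t" using st(3) by (auto split: if_splits)
  qed
  then show ?thesis by (rule card_inj_on_le[OF _ im finites(3)])
next
  case False
  \<comment> \<open>The value \<open>0\<close> stands for the case that \<open>A\<close> has no element up to \<open>n / 3\<close>; no number lies below
    \<open>3 * z\<close> then, and all of \<open>thirds e\<close> is shifted.\<close>
  define z where "z = Max (insert 0 {a \<in> A. 3 * a \<le> n})"
  have fin: "finite (insert 0 {a \<in> A. 3 * a \<le> n})" using finites by auto
  have z: "z = 0 \<or> z \<in> A" "3 * z \<le> n" using Max_in[OF fin] by (auto simp: z_def)
  have zmax: "a \<le> z" if "a \<in> A" "3 * a \<le> n" for a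
    using Max_ge[OF fin, of a] that by (auto simp: z_def)
  let ?f = "\<lambda>s. if s < 3 * z then 3 * z - s else if e = 1 then s + 1 else s - 1"
  have large: "3 * z < ?f s \<and> ?f s \<in> gaps (3 - e)" if s1: "s \<in> thirds e" "\<not> s < 3 * z" for s
  proof -
    note b = thirds_bounds[OF s1(1)]
    have s: "3 * z + e \<le> s"
    proof -
      have "s mod 3 = e" using b by simp
      then obtain q where "s = 3 * q + e" by (rule mod_3_E)
      then show ?thesis using s1(2) e by presburger
    qed
    define g where "g = (if e = 1 then s + 1 else s - 1)"
    have g: "?f s = g" using s1 by (simp add: g_def)
    have g12: "e = 1 \<and> g = s + 1 \<or> e = 2 \<and> g + 1 = s" using e b by (auto simp: g_def)
    have cls: "g mod 3 = 3 - e"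
    proof -
      have "s mod 3 = e" using b by simp
      then obtain q where "s = 3 * q + e" by (rule mod_3_E)
      then have "g = 3 * q + (3 - e)" using g12 by linarith
      then show ?thesis using g12 by auto
    qed
    have "g \<notin> A"
    proof
      assume A: "g \<in> A"
      have "\<not> 3 * g \<le> n" using zmax[OF A] g12 s by auto
      then have "e = 1 \<and> s = n div 3" using g12 b by linarith
      then show False using False A b g12 by auto
    qed
    moreover have "1 \<le> g" "g \<le> n" "3 * z < g" using s b assms(1) g12 by linarith+
    ultimately show ?thesis unfolding g using cls by (auto simp: gaps_def)
  qed
  have im: "?f ` thirds e \<subseteq> gaps (3 - e)"
  proof clarify
    fix s assume s1: "s \<in> thirds e"
    show "?f s \<in> gaps (3 - e)"
    proof (cases "s < 3 * z")
      case True
      then show ?thesis using reflect_gap[OF _ s1 e True] z by auto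
    next
      case False
      then show ?thesis using large[OF s1] by auto
    qed
  qed
  have fgt: "s < 3 * z \<longleftrightarrow> \<not> 3 * z < ?f s" if "s \<in> thirds e" for s
    using conjunct1[OF large[OF that]] by (cases "s < 3 * z") simp_all
  have "inj_on ?f (thirds e)"
  proof (rule inj_onI)
    fix s t assume st: "s \<in> thirds e" "t \<in> thirds e" "?f s = ?f t"
    have iff: "s < 3 * z \<longleftrightarrow> t < 3 * z"
      using fgt[OF st(1)] fgt[OF st(2)] unfolding st(3) by blast
    have "1 \<le> s" "1 \<le> t" using thirds_bounds st(1,2) by auto
    show "s = t"
    proof (cases "s < 3 * z")
      case True
      then have "3 * z - s = 3 * z - t" "t < 3 * z" using st(3) iff by simp_all
      then show ?thesis using True by linarith
    next
      case False
      then have "(if e = 1 then s + 1 else s - 1) = (if e = 1 then t + 1 else t - 1)"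
        using st(3) iff by simp
      then show ?thesis using \<open>1 \<le> s\<close> \<open>1 \<le> t\<close> by (simp split: if_splits)
    qed
  qed
  then show ?thesis by (rule card_inj_on_le[OF _ im finites(3)])
qed

text \<open>The sumset \<open>ninths e + thirds e\<close> consists of gaps and has at least
  \<open>card (ninths e) + card (thirds e) - 1\<close> elements. Suppose that there is no further gap. Then the
  gaps are exactly the chain \<open>W\<close> spanned by the minimum \<open>r\<close> of the first set and the maximum \<open>s'\<close> of
  the second one. In particular every number of class \<open>3 - e\<close> below \<open>r + s\<close> is a member, and for all
  but four pairs \<open>(r, s)\<close> there are \<open>y, z\<close> among these small members with \<open>3 s + 3 y = 9 z\<close>. In the
  four remaining cases the contradiction comes from the other end: no gap exceeds \<open>r' + s'\<close>, so by
  reflection \<open>A\<close> has no element in a long interval that contains \<open>n / 3\<close>. If a number \<open>r + 3\<close> can be a ninth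
  at all, it is one; then \<open>thirds e\<close> is a full arithmetic progression with difference \<open>3\<close>, and the
  triples of its elements cannot avoid this interval. Otherwise \<open>ninths e = {r}\<close>, and a few particular
  numbers settle the matter.\<close>

lemma card_ninths_thirds_le_card_gaps:
  assumes "27 \<le> n" and e: "e = 1 \<or> e = 2"
    and "ninths e \<noteq> {}" "thirds e \<noteq> {}"
  shows "card (ninths e) + card (thirds e) \<le> card (gaps (3 - e))"
proof (rule ccontr)
  assume less: "\<not> card (ninths e) + card (thirds e) \<le> card (gaps (3 - e))"
  define r s r' s' where "r = Min (ninths e)" and "s = Min (thirds e)"
    and "r' = Max (ninths e)" and "s' = Max (thirds e)"
  define W where "W = (+) r ` thirds e \<union> (\<lambda>x. x + s') ` ninths e"
  have in_sets: "r \<in> ninths e" "s \<in> thirds e" "r' \<in> ninths e" "s' \<in> thirds e"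
    using assms finites by (auto simp: r_def s_def r'_def s'_def)
  have r_le: "r \<le> x \<and> x \<le> r'" if "x \<in> ninths e" for x
    using that finites by (simp add: r_def r'_def)
  have s_le: "s \<le> x \<and> x \<le> s'" if "x \<in> thirds e" for x
    using that finites by (simp add: s_def s'_def)
  note b = ninths_bounds[OF in_sets(1)] thirds_bounds[OF in_sets(2)]
    ninths_bounds[OF in_sets(3)] thirds_bounds[OF in_sets(4)] r_le[OF in_sets(3)] s_le[OF in_sets(4)]
  have bb: "9 * r' \<le> n" "1 \<le> r" "3 * s' \<le> n" "s \<le> s'" "r \<le> r'" using b by auto
  have "W \<subseteq> gaps (3 - e)" using sum_gap e in_sets by (auto simp: W_def)
  moreover have "card (ninths e) + card (thirds e) \<le> card W + 1"
    using Min_translate_Un_translate_Max[of "ninths e" "thirds e"] finites assms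
    by (simp add: W_def r_def s'_def)
  ultimately have gaps_eq: "gaps (3 - e) = W"
    using less card_seteq[OF finites(3), of W "3 - e"] by simp
  have gap_range: "r + s \<le> x \<and> x \<le> r' + s'" if "x \<in> gaps (3 - e)" for x
  proof -
    have "x \<in> W" using that gaps_eq by simp
    then consider t where "t \<in> thirds e" "x = r + t" | t where "t \<in> ninths e" "x = t + s'"
      by (auto simp: W_def)
    then show ?thesis
    proof cases
      case 1
      then show ?thesis using s_le[of t] b by linarith
    next
      case 2
      then show ?thesis using r_le[of t] b by linarith
    qed
  qed
  have low: "x \<in> A" if "x mod 3 = 3 - e" "1 \<le> x" "x < r + s" for x
  proof (rule ccontr)
    assume "x \<notin> A"
    moreover have "x \<le> n" using that b assms(1) by linarith
    ultimately have "x \<in> gaps (3 - e)" using that by (simp add: gaps_def)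
    then show False using gap_range[of x] that by linarith
  qed
  have s_mod: "s mod 3 = e" and s'_mod: "s' mod 3 = e" and r_mod: "r mod 3 = e" using b by auto
  have exceptional: "e = 1 \<and> r = 1 \<and> s = 1 \<or> e = 1 \<and> r = 4 \<and> s = 1 \<or>
      e = 1 \<and> r = 1 \<and> s = 7 \<or> e = 2 \<and> r = 2 \<and> s = 5"
  proof -
    \<comment> \<open>For even \<open>s\<close> the members \<open>y = z = s / 2\<close> solve \<open>s + y = 3 z\<close>.\<close>
    have odd: "odd s"
    proof
      assume "even s"
      then obtain z where z: "s = 2 * z" by (auto elim: evenE)
      have "z mod 3 = 3 - e" using s_mod z e by presburger
      then have "z \<in> A" using low[of z] z b by linarith
      then show False using no[of "3 * s" z z] b z by simp
    qed
    \<comment> \<open>For odd \<open>s\<close> the members \<open>y = (s + 9) / 2\<close> and \<open>z = (s + 3) / 2\<close> solve \<open>s + y = 3 z\<close>, if they are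
      below \<open>r + s\<close>.\<close>
    have le9: "2 * r + s \<le> 9"
    proof (rule ccontr)
      assume large: "\<not> 2 * r + s \<le> 9"
      obtain k where k: "s = 2 * k + 1" using odd by (auto elim: oddE)
      have cls: "(k + 2) mod 3 = 3 - e" "(k + 5) mod 3 = 3 - e" using s_mod k e by presburger+
      have "k + 2 < r + s" "k + 5 < r + s" using k large b by linarith+
      then have "k + 2 \<in> A" "k + 5 \<in> A" using low cls by simp_all
      then show False using no[of "3 * s" "k + 5" "k + 2"] b k by simp
    qed
    have "1 \<le> r" "1 \<le> s" using b by auto
    then have le: "r \<le> 4" "s \<le> 7" using le9 by linarith+
    show ?thesis using e
    proof
      assume e1: "e = 1"
      then have "r = 1 \<or> r = 4" "s = 1 \<or> s = 7" using le r_mod s_mod odd by presburger+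
      then show ?thesis using e1 le9 by auto
    next
      assume e2: "e = 2"
      then have "r = 2" "s = 5" using le r_mod s_mod odd by presburger+
      then show ?thesis using e2 by simp
    qed
  qed
  have gap_free: "z \<notin> A" if z: "r' + s' + s < 3 * z" "3 * z \<le> n + s'" for z
  proof
    assume zA: "z \<in> A"
    show False
    \<comment> \<open>Reflecting \<open>s\<close> at \<open>z\<close>, or \<open>s'\<close> if this exceeds \<open>n\<close>, would give a gap above \<open>r' + s'\<close>.\<close>
    proof (cases "3 * z \<le> n + s")
      case True
      then have "3 * z - s \<in> gaps (3 - e)" using reflect_gap[OF zA in_sets(2) e] z by linarith
      then show False using gap_range[of "3 * z - s"] z by linarith
    next
      case False
      then have "r' + s' + s' < 3 * z" using b by linarith
      moreover from this have "3 * z - s' \<in> gaps (3 - e)" using reflect_gap[OF zA in_sets(4) e] z by linarith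
      ultimately show False using gap_range[of "3 * z - s'"] z by linarith
    qed
  qed
  have window: "x \<in> W" if x: "r' + s' + s < 3 * x" "3 * x \<le> n + s'" "x mod 3 = 3 - e" for x
  proof -
    have "x \<notin> A" using gap_free x by blast
    then have "x \<in> gaps (3 - e)" using x b by (auto simp: gaps_def)
    then show ?thesis using gaps_eq by simp
  qed
  \<comment> \<open>The largest number of class \<open>3 - e\<close> in the interval free of members is a gap, so it is at most
    \<open>r' + s'\<close>. As the interval ends at \<open>(n + s') / 3\<close>, this forces \<open>s'\<close> to be close to \<open>n / 3\<close>.\<close>
  have s'_large: "n < 2 * s' + 3 * r' + 9"
  proof -
    have "3 - e < 3" "3 - e \<le> (n + s') div 3" using e assms(1) by auto
    then obtain x where x: "x mod 3 = 3 - e" "x \<le> (n + s') div 3" "(n + s') div 3 < x + 3"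
      using ex_residue_3 by blast
    then have x3: "3 * x \<le> n + s'" "n + s' < 3 * x + 9" by linarith+
    show ?thesis
    proof (cases "r' + s' + s < 3 * x")
      case True
      then have "x \<in> gaps (3 - e)" using window x3 x(1) gaps_eq by blast
      then show ?thesis using gap_range[of x] x3 by linarith
    next
      case False
      have "s \<le> 7" using exceptional by auto
      then show ?thesis using False x3 b assms(1) by linarith
    qed
  qed
  show False
  proof (cases "9 * (r + 3) \<le> n")
    case True
    \<comment> \<open>For \<open>(r, s) = (1, 7)\<close> the members \<open>2\<close> and \<open>5\<close> exclude \<open>10\<close> and \<open>13\<close> from \<open>thirds e\<close>, so its maximum
      is \<open>7\<close>, which is too small, or at least \<open>16\<close>.\<close>
    have big: "s = 7 \<Longrightarrow> 48 \<le> n \<and> 16 \<le> s'"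
    proof -
      assume s7: "s = 7"
      then have e1: "e = 1" and r1: "r = 1" using exceptional by auto
      have A: "2 \<in> A" "5 \<in> A" using low[of 2] low[of 5] s7 r1 e1 by simp_all
      have "10 \<notin> thirds e" using no[of 30 5 5] A by (auto simp: thirds_def)
      moreover have "13 \<notin> thirds e" using no[of 39 2 5] A by (auto simp: thirds_def)
      ultimately have "s' \<noteq> 10" "s' \<noteq> 13" using in_sets by auto
      moreover have "s' \<noteq> 7"
      proof
        assume s'7: "s' = 7"
        have "20 \<in> gaps (3 - e)" using reflect_gap[of 9 7 e] in_sets b r1 s7 e assms(1) by simp
        then consider t where "t \<in> thirds e" "20 = r + t" | t where "t \<in> ninths e" "20 = t + s'"
          by (auto simp: gaps_eq W_def)
        then show False
        proof cases
          case 1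
          then show False using s_le[of t] s'7 r1 by simp
        next
          case 2
          then have "117 \<le> n" using ninths_bounds[of t e] s'7 by simp
          then show False using s'_large b s'7 by simp
        qed
      qed
      moreover have "7 \<le> s'" using b s7 by simp
      moreover have "s' mod 3 = 1" using s'_mod e1 by simp
      ultimately have "16 \<le> s'" by presburger
      then show "48 \<le> n \<and> 16 \<le> s'" using b by linarith
    qed
    \<comment> \<open>Gaps above \<open>r + s'\<close> come only from the translate of \<open>ninths e\<close>; this determines the second
      smallest ninth.\<close>
    have step: "r + 3 \<in> ninths e"
    proof -
      have "(s' + (r + 3)) mod 3 = 3 - e" using mod_3_add[of s' e "r + 3"] s'_mod r_mod e by simp
      moreover have "r' + s' + s < 3 * (s' + (r + 3))" "3 * (s' + (r + 3)) \<le> n + s'"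
        using True s'_large bb unfolding distrib_left by linarith+
      ultimately have "s' + (r + 3) \<in> W" using window by blast
      then consider t where "t \<in> thirds e" "s' + (r + 3) = r + t" | t where "t \<in> ninths e" "s' + (r + 3) = t + s'"
        by (auto simp: W_def)
      then show ?thesis
      proof cases
        case 1
        then show ?thesis using s_le[of t] by linarith
      next
        case 2
        then have "t = r + 3" by linarith
        then show ?thesis using 2 by simp
      qed
    qed
    \<comment> \<open>The gap \<open>(r + 3) + c\<close> must lie on the chain, which gives the next third.\<close>
    have up: "c + 3 \<in> thirds e" if c: "c \<in> thirds e" "c < s'" for c
    proof -
      have "c mod 3 = e" using thirds_bounds[OF c(1)] by simp
      then have c3: "c + 3 \<le> s'" using mod_3_less[OF _ s'_mod] c(2) by blast
      have "(r + 3) + c \<in> W" using sum_gap[OF step c(1) e] gaps_eq by simp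
      then consider t where "t \<in> thirds e" "(r + 3) + c = r + t" | t where "t \<in> ninths e" "(r + 3) + c = t + s'"
        by (auto simp: W_def)
      then show ?thesis
      proof cases
        case 1
        then show ?thesis by (simp add: add.commute)
      next
        case 2
        then have "c + 3 = s'" using r_le[of t] c3 by linarith
        then show ?thesis using in_sets by simp
      qed
    qed
    have all: "s + 3 * i \<in> thirds e" if "s + 3 * i \<le> s'" for i
      using that
    proof (induction i)
      case 0
      then show ?case using in_sets by simp
    next
      case (Suc i)
      then have "(s + 3 * i) + 3 \<in> thirds e" using up[of "s + 3 * i"] by simp
      moreover have "(s + 3 * i) + 3 = s + 3 * Suc i" by simp
      ultimately show ?case by metis
    qed
    \<comment> \<open>The largest \<open>c\<close> of class \<open>e\<close> with \<open>9 c \<le> n + s'\<close> is a third, and \<open>3 c\<close> lies in the interval free of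
      members.\<close>
    have "e < 3" "e \<le> (n + s') div 9" using e assms(1) by auto
    then obtain c where c: "c mod 3 = e" "c \<le> (n + s') div 9" "(n + s') div 9 < c + 3"
      using ex_residue_3 by blast
    define k where "k = (n + s') div 9"
    have "9 * k \<le> n + s'" "n + s' < 9 * k + 9" by (auto simp: k_def)
    then have c9: "9 * c \<le> n + s'" "n + s' < 9 * c + 27" using c(2,3) unfolding k_def[symmetric] by linarith+
    have "s \<le> c"
    proof -
      have "s = 1 \<or> s = 7 \<or> s = 5 \<and> r = 2" using exceptional by blast
      then have "9 * s \<le> n + s'" using big True by auto
      then have "s < c + 3" using c9 by linarith
      then show ?thesis using mod_3_less[OF c(1) s_mod] by linarith
    qed
    then obtain i where "c = s + 3 * i"
      using mod_eq_dvd_iff_nat[of s c 3] c(1) s_mod by (metis dvdE le_add_diff_inverse)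
    moreover have "c \<le> s'" using c9 s'_large b assms(1) by linarith
    ultimately have "c \<in> thirds e" using all by simp
    then have "3 * c \<in> A" using thirds_bounds by blast
    moreover have "r' + s' + s < 9 * c"
    proof -
      have "s = 1 \<or> s = 7 \<or> s = 5 \<and> r = 2" using exceptional by blast
      then have "r' + s < n - 26" using big bb True by auto
      then show ?thesis using c9 by linarith
    qed
    ultimately show False using gap_free[of "3 * c"] c9 by simp
  next
    case False
    \<comment> \<open>In this case \<open>r\<close> is the only ninth, so every gap is \<open>r + c\<close> with a third \<open>c\<close>. Particular gaps
      then force thirds \<open>c\<close> with \<open>3 c > n\<close>; for \<open>(r, s) = (2, 5)\<close> this only bounds \<open>n\<close>, which leaves \<open>8\<close> and
      \<open>11\<close> for \<open>s'\<close>, and both are excluded by the members \<open>1\<close> and \<open>4\<close>.\<close>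
    have "x = r" if "x \<in> ninths e" for x
    proof -
      have "x < r + 3" "r \<le> x" "x mod 3 = e" using ninths_bounds[OF that] r_le[OF that] False by auto
      then show ?thesis using mod_3_less[OF r_mod, of x] by linarith
    qed
    then have single: "ninths e = {r}" using in_sets by auto
    then have r': "r' = r" by (simp add: r'_def)
    have down: "x - r \<in> thirds e" if "x \<in> gaps (3 - e)" for x
      using that in_sets by (auto simp: gaps_eq W_def single add.commute)
    consider "e = 1" "r = 1" "s = 1" | "e = 1" "r = 4" "s = 1" | "e = 1" "r = 1" "s = 7" | "e = 2" "r = 2" "s = 5"
      using exceptional by blast
    then show False
    proof cases
      case 1
      have "26 \<in> gaps (3 - e)" using reflect_gap[of 9 1 e] in_sets b 1 e assms(1) by simp
      then show False using thirds_bounds[OF down[of 26]] False 1 by simp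
    next
      case 2
      have "8 \<in> gaps (3 - e)" using reflect_gap[of 3 1 e] in_sets b 2 e assms(1) by simp
      then have "12 \<in> A" using thirds_bounds[OF down[of 8]] 2 by simp
      then have "35 \<in> gaps (3 - e)" using reflect_gap[of 12 1 e] in_sets b 2 e by simp
      then show False using thirds_bounds[OF down[of 35]] False 2 by simp
    next
      case 3
      have "20 \<in> gaps (3 - e)" using reflect_gap[of 9 7 e] in_sets b 3 e assms(1) by simp
      then show False using thirds_bounds[OF down[of 20]] False 3 by simp
    next
      case 4
      have A: "1 \<in> A" "4 \<in> A" "15 \<in> A" using low[of 1] low[of 4] 4 b by simp_all
      have "n < 40"
      proof (rule ccontr)
        assume "\<not> n < 40"
        then have "40 \<in> gaps (3 - e)" using reflect_gap[of 15 5 e] in_sets A 4 e by simp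
        then show False using thirds_bounds[OF down[of 40]] False 4 by simp
      qed
      then have "6 < s'" "s' < 14" using s'_large r' 4 b assms(1) by linarith+
      then have "s' = 8 \<or> s' = 11" using s'_mod 4(1) by presburger
      moreover have "8 \<notin> thirds e" using no[of 24 4 4] A by (auto simp: thirds_def)
      moreover have "11 \<notin> thirds e" using no[of 33 1 4] A by (auto simp: thirds_def)
      ultimately show False using in_sets by auto
    qed
  qed
qed

text \<open>Only a step from \<open>m\<close> to \<open>3 k = m + 1\<close> with \<open>3 k \<in> A\<close> is critical. There the lists give \<open>k\<close>
  disjoint blocks below \<open>3 k\<close>, none of which lies in \<open>A\<close>: each block is completed to a solution of the
  equation, if it is not one already, by adding \<open>3 k\<close> itself.\<close>

lemma card_Int_le_of_le_26:
  assumes "m \<le> 26"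
  shows "card (A \<inter> {1..m}) \<le> m - m div 3"
  using assms
proof (induction m)
  case (Suc m)
  then have IH: "card (A \<inter> {1..m}) \<le> m - m div 3" by simp
  have split: "A \<inter> {1..Suc m} = (if Suc m \<in> A then insert (Suc m) (A \<inter> {1..m}) else A \<inter> {1..m})"
    by (auto simp: le_Suc_eq)
  show ?case
  proof (cases "Suc m \<in> A \<and> 3 dvd Suc m")
    case False
    then have "card (A \<inter> {1..Suc m}) \<le> card (A \<inter> {1..m}) + (if 3 dvd Suc m then 0 else 1)"
      using split by auto
    moreover have "m - m div 3 + (if 3 dvd Suc m then 0 else 1) \<le> Suc m - Suc m div 3"
      using div_le_dividend[of m 3] by (simp add: div_Suc dvd_eq_mod_eq_0)
    ultimately show ?thesis using IH by linarith
  next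
    case True
    then obtain k where k: "Suc m = 3 * k" by (auto elim: dvdE)
    have "card (A \<inter> {1..3 * k}) + k \<le> 3 * k"
    proof -
      have "k \<in> {1, 2, 3, 4, 5, 6, 7, 8}" using k Suc.prems by auto
      then consider "k = 1" | "k = 2" | "k = 3" | "k = 4" | "k = 5" | "k = 6" | "k = 7" | "k = 8" by blast
      then show ?thesis
      proof cases
        case 1
        then have "3 \<in> A" using True k by simp
        then show ?thesis using card_Int_add_length_le[of "[[1, 2]]" 3 A] no[of 3 2 1] 1 by auto
      next
        case 2
        then have "6 \<in> A" using True k by simp
        then show ?thesis using card_Int_add_length_le[of "[[1], [2, 4]]" 6 A] no[of 6 1 1] no[of 6 4 2] 2 by auto
      next
        case 3
        then have "9 \<in> A" using True k by simp
        then show ?thesis using card_Int_add_length_le[of "[[4], [2, 3], [1, 6]]" 9 A]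
          no[of 9 9 4] no[of 9 3 2] no[of 6 1 1] 3 by auto
      next
        case 4
        then have "12 \<in> A" using True k by simp
        then show ?thesis using card_Int_add_length_le[of "[[2], [4, 9], [1, 6], [3, 8]]" 12 A]
          no[of 12 2 2] no[of 9 9 4] no[of 6 1 1] no[of 3 8 3] 4 by auto
      next
        case 5
        then have "15 \<in> A" using True k by simp
        then show ?thesis using card_Int_add_length_le[of "[[5, 10], [4, 9], [2, 12], [1, 6], [3, 8]]" 15 A]
          no[of 15 10 5] no[of 9 9 4] no[of 12 2 2] no[of 6 1 1] no[of 3 8 3] 5 by auto
      next
        case 6
        then have "18 \<in> A" using True k by simp
        then show ?thesis
          using card_Int_add_length_le[of "[[8], [4, 9], [2, 12], [1, 6], [7, 15, 16], [3, 5, 14]]" 18 A]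
          no[of 18 18 8] no[of 9 9 4] no[of 12 2 2] no[of 6 1 1] no[of 15 16 7] no[of 3 14 5] 6 by auto
      next
        case 7
        then have "21 \<in> A" using True k by simp
        then show ?thesis
          using card_Int_add_length_le[of "[[7, 14], [9, 20], [3, 4, 11], [5, 10, 15], [8, 18], [2, 12], [1, 6]]" 21 A]
          no[of 21 14 7] no[of 21 20 9] no[of 3 11 4] no[of 15 10 5] no[of 18 18 8] no[of 12 2 2] no[of 6 1 1] 7 by auto
      next
        case 8
        then have "24 \<in> A" using True k by simp
        then show ?thesis
          using card_Int_add_length_le[of "[[4], [9], [2, 12], [8, 18], [1, 3], [6, 16], [5, 10, 15], [7, 14, 21]]" 24 A]
          no[of 24 4 4] no[of 9 24 9] no[of 12 2 2] no[of 18 18 8] no[of 24 1 3] no[of 6 16 6]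
          no[of 15 10 5] no[of 21 14 7] 8 by auto
      qed
    qed
    then show ?thesis using k by simp
  qed
qed simp

text \<open>The number of ninths of both classes is bounded by the gaps of either class that contains a
  ninth. This is the substitute for \<open>card_ninths_thirds_le_card_gaps\<close> when \<open>thirds e\<close> is empty.\<close>

lemma card_all_ninths_le_card_gaps:
  assumes "t \<in> ninths e" "e = 1 \<or> e = 2"
  shows "card (ninths 1) + card (ninths 2) \<le> card (gaps e)"
proof -
  let ?f = "\<lambda>s. t + 3 * s"
  have "?f ` (ninths 1 \<union> ninths 2) \<subseteq> gaps e"
    using quadruple_gap[OF assms(1)] ninths_bounds by blast
  then have "card (ninths 1 \<union> ninths 2) \<le> card (gaps e)"
    using card_inj_on_le[of ?f, OF _ _ finites(3)] by (simp add: inj_on_def)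
  moreover have "card (ninths 1 \<union> ninths 2) = card (ninths 1) + card (ninths 2)"
    by (rule card_Un_disjoint) (auto simp: finites, auto simp: ninths_def)
  ultimately show ?thesis by simp
qed

text \<open>Let \<open>F = thirds (3 - e)\<close>, \<open>f'\<close> its maximum and \<open>G\<close> the numbers \<open>x\<close> of the same class as \<open>F\<close> with
  \<open>f' < 3 x \<le> n\<close>; since \<open>f' \<le> n / 3\<close>, there are more such numbers than ninths of class \<open>e\<close>. Elements of \<open>G\<close> outside
  \<open>A\<close> are gaps of class \<open>3 - e\<close>. Elements \<open>a\<close> of \<open>G\<close> inside \<open>A\<close> give the gaps \<open>3 a - f\<close> of class \<open>e\<close>, at
  least \<open>card (G \<inter> A) + card F - 1\<close> in number. Hence \<open>card G + card F - 1\<close> gaps are found in total if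
  \<open>G\<close> meets \<open>A\<close>. Otherwise all of \<open>G\<close> consists of gaps and the gaps of class \<open>e\<close> are at least as many as \<open>F\<close>.\<close>

lemma card_ninths_opposite_thirds_le:
  assumes "27 \<le> n" and e: "e = 1 \<or> e = 2"
    and ne: "ninths e \<noteq> {}"
  shows "card (ninths e) + card (thirds (3 - e)) \<le> card (gaps e) + card (gaps (3 - e))"
proof (cases "thirds (3 - e) = {}")
  case True
  obtain t where "t \<in> ninths e" using ne by blast
  then have "card (ninths e) \<le> card (gaps e)"
    using card_all_ninths_le_card_gaps[of t e] e by auto
  then show ?thesis using True by simp
next
  case False
  let ?F = "thirds (3 - e)"
  define f' where "f' = Max ?F"
  have f': "f' \<in> ?F" using False finites by (simp add: f'_def)
  have f_le: "f \<le> f'" if "f \<in> ?F" for f using that finites by (simp add: f'_def)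
  have e': "3 - e = 1 \<or> 3 - e = 2" "3 - (3 - e) = e" using e by auto
  define m where "m = n div 9"
  define G where "G = {x \<in> {1..n div 3}. x mod 3 = 3 - e} - {x \<in> {1..f' div 3}. x mod 3 = 3 - e}"
  have G_iff: "x \<in> G \<longleftrightarrow> x mod 3 = 3 - e \<and> f' < 3 * x \<and> 3 * x \<le> n" for x
  proof -
    have "x \<le> n div 3 \<longleftrightarrow> 3 * x \<le> n" "x \<le> f' div 3 \<longleftrightarrow> \<not> f' < 3 * x" by auto
    then show ?thesis by (auto simp: G_def)
  qed
  have fin: "finite G" by (simp add: G_def)
  have card_G: "card (ninths e) + 1 \<le> card G"
  proof -
    have "f' div 3 \<le> n div 3 div 3" using thirds_bounds[OF f'] by (intro div_le_mono) linarith
    then have "f' div 3 \<le> m" by (simp add: m_def div_mult2_eq[symmetric])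
    then have 1: "(f' div 3 + 3 - (3 - e)) div 3 \<le> (m + 3 - (3 - e)) div 3"
      by (intro div_le_mono) simp
    have "3 * m \<le> n div 3" by (simp add: m_def)
    then have 2: "(3 * m + 3 - (3 - e)) div 3 \<le> (n div 3 + 3 - (3 - e)) div 3"
      by (intro div_le_mono) simp
    have 3: "card G = (n div 3 + 3 - (3 - e)) div 3 - (f' div 3 + 3 - (3 - e)) div 3"
    proof -
      have "f' div 3 \<le> n div 3" using thirds_bounds[OF f'] by (intro div_le_mono) linarith
      then have "{x \<in> {1..f' div 3}. x mod 3 = 3 - e} \<subseteq> {x \<in> {1..n div 3}. x mod 3 = 3 - e}" by auto
      then show ?thesis unfolding G_def
        using card_Diff_subset[of "{x \<in> {1..f' div 3}. x mod 3 = 3 - e}" "{x \<in> {1..n div 3}. x mod 3 = 3 - e}"]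
          card_residue_3[OF e'(1)] by simp
    qed
    have "ninths e \<subseteq> {x \<in> {1..m}. x mod 3 = e}" by (auto simp: m_def dest: ninths_bounds)
    then have "card (ninths e) \<le> card {x \<in> {1..m}. x mod 3 = e}" by (intro card_mono) auto
    then have 4: "card (ninths e) \<le> (m + 3 - e) div 3" using card_residue_3[OF e] by simp
    have "3 \<le> m" using assms(1) by (simp add: m_def)
    then have 5: "(m + 3 - e) div 3 + 1 + (m + 3 - (3 - e)) div 3 \<le> (3 * m + 3 - (3 - e)) div 3"
      using e residue_counts[of m] by (elim disjE) simp_all
    have arith: "r + 1 \<le> g" if "a \<le> b" "c \<le> d" "g = d - a" "r \<le> s" "s + 1 + b \<le> c" for a b c d g r s :: nat
      using that by linarith
    show ?thesis using arith[OF 1 2 3 4 5] .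
  qed
  have diff: "card (G - A) \<le> card (gaps (3 - e))"
    by (rule card_mono[OF finites(3)]) (auto simp: G_iff gaps_def)
  show ?thesis
  proof (cases "G \<inter> A = {}")
    case True
    then have "card G \<le> card (gaps (3 - e))" using diff by (simp add: Diff_triv)
    moreover have "card ?F \<le> card (gaps e)"
      using card_thirds_le_card_gaps[OF _ e'(1)] e'(2) assms(1) by simp
    ultimately show ?thesis using card_G by linarith
  next
    case False
    define a' where "a' = Max (G \<inter> A)"
    have a': "a' \<in> G \<inter> A" using False fin by (metis Max_in a'_def finite_Int)
    have a_le: "a \<le> a'" if "a \<in> G \<inter> A" for a using that fin by (simp add: a'_def)
    let ?U = "(\<lambda>a. 3 * a - f') ` (G \<inter> A)" and ?V = "(\<lambda>f. 3 * a' - f) ` ?F"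
    have "?U \<union> ?V \<subseteq> gaps e"
    proof -
      have "3 * a - f \<in> gaps e" if "a \<in> G \<inter> A" "f \<in> ?F" for a f
        using reflect_gap[of a f "3 - e"] that f_le[OF that(2)] e' by (auto simp: G_iff)
      then show ?thesis using a' f' by blast
    qed
    then have "card (?U \<union> ?V) \<le> card (gaps e)" by (rule card_mono[OF finites(3)])
    moreover have "?U \<inter> ?V \<subseteq> {3 * a' - f'}"
    proof
      fix w assume "w \<in> ?U \<inter> ?V"
      then obtain a f where w: "w = 3 * a - f'" "w = 3 * a' - f" "a \<in> G \<inter> A" "f \<in> ?F" by blast
      then have "f' < 3 * a" "f < 3 * a'" "a \<le> a'" "f \<le> f'"
        using a_le f_le[of f] a' by (auto simp: G_iff intro: le_less_trans)
      then have "a = a'" using w by linarith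
      then show "w \<in> {3 * a' - f'}" using w by simp
    qed
    then have "card ?U + card ?V \<le> card (?U \<union> ?V) + 1"
      using card_add_le_card_Un[of ?U ?V "3 * a' - f'"] fin finites by simp
    moreover have "card ?U = card (G \<inter> A)"
    proof (rule card_image, rule inj_onI)
      fix a b assume "a \<in> G \<inter> A" "b \<in> G \<inter> A" "3 * a - f' = 3 * b - f'"
      then show "a = b" by (auto simp: G_iff)
    qed
    moreover have "card ?V = card ?F"
    proof (rule card_image, rule inj_onI)
      fix f g assume fg: "f \<in> ?F" "g \<in> ?F" "3 * a' - f = 3 * a' - g"
      have "f' < 3 * a'" using a' by (auto simp: G_iff)
      then show "f = g" using f_le[OF fg(1)] f_le[OF fg(2)] fg(3) by linarith
    qed
    moreover have "card G = card (G \<inter> A) + card (G - A)"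
      using fin by (metis Int_Diff_Un card_Un_disjoint finite_Diff finite_Int Int_Diff_disjoint)
    ultimately show ?thesis using card_G diff by linarith
  qed
qed

text \<open>Thirds and ninths of class \<open>e\<close> are charged to the gaps of class \<open>3 - e\<close> whenever both kinds
  occur. The remaining cases are settled by the reflections alone, or by the bounds above that take the
  ninths of a class without thirds.\<close>

lemma card_multiples_le_card_gaps:
  assumes "27 \<le> n"
  shows "card (thirds 1) + card (thirds 2) + card (ninths 1) + card (ninths 2)
    \<le> card (gaps 1) + card (gaps 2)"
proof -
  have Z: "card (thirds 1) \<le> card (gaps 2)" "card (thirds 2) \<le> card (gaps 1)"
    using card_thirds_le_card_gaps[of 1] card_thirds_le_card_gaps[of 2] assms by (simp_all add: numeral_eq_Suc)
  have K1: "card (ninths 1) + card (thirds 1) \<le> card (gaps 2)" if "ninths 1 \<noteq> {}" "thirds 1 \<noteq> {}"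
    using card_ninths_thirds_le_card_gaps[of 1] that assms by (simp add: numeral_eq_Suc)
  have K2: "card (ninths 2) + card (thirds 2) \<le> card (gaps 1)" if "ninths 2 \<noteq> {}" "thirds 2 \<noteq> {}"
    using card_ninths_thirds_le_card_gaps[of 2] that assms by (simp add: numeral_eq_Suc)
  have W1: "card (ninths 1) + card (thirds 2) \<le> card (gaps 1) + card (gaps 2)" if "ninths 1 \<noteq> {}"
    using card_ninths_opposite_thirds_le[of 1] that assms by (simp add: numeral_eq_Suc)
  have W2: "card (ninths 2) + card (thirds 1) \<le> card (gaps 1) + card (gaps 2)" if "ninths 2 \<noteq> {}"
    using card_ninths_opposite_thirds_le[of 2] that assms by (simp add: numeral_eq_Suc)
  have T1: "card (ninths 1) + card (ninths 2) \<le> card (gaps 1)" if "ninths 1 \<noteq> {}"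
    using card_all_ninths_le_card_gaps[of _ 1] that by blast
  have T2: "card (ninths 1) + card (ninths 2) \<le> card (gaps 2)" if "ninths 2 \<noteq> {}"
    using card_all_ninths_le_card_gaps[of _ 2] that by blast
  show ?thesis
  proof (cases "ninths 1 = {}"; cases "ninths 2 = {}")
    assume "ninths 1 = {}" "ninths 2 = {}"
    then show ?thesis using Z by simp
  next
    assume "ninths 1 = {}" "ninths 2 \<noteq> {}"
    then show ?thesis using Z K2 W2 by (cases "thirds 2 = {}") simp_all
  next
    assume "ninths 1 \<noteq> {}" "ninths 2 = {}"
    then show ?thesis using Z K1 W1 by (cases "thirds 1 = {}") simp_all
  next
    assume "ninths 1 \<noteq> {}" "ninths 2 \<noteq> {}"
    then show ?thesis using K1 K2 T1 T2 by (cases "thirds 1 = {}"; cases "thirds 2 = {}") simp_all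
  qed
qed

lemma card_not_dvd_27_le:
  "card {x \<in> A. \<not> 27 dvd x} \<le> card {x \<in> {1..n}. \<not> 3 dvd x}"
proof (cases "27 \<le> n")
  case False
  have "card {x \<in> A. \<not> 27 dvd x} \<le> card (A \<inter> {1..n})"
    using finites sub by (intro card_mono) auto
  then show ?thesis using card_Int_le_of_le_26[of n] False card_not_dvd[of 3 n] by simp
next
  case True
  let ?N = "{x \<in> {1..n}. \<not> 3 dvd x}"
  have "{x \<in> A. \<not> 27 dvd x} \<subseteq> (?N \<inter> A) \<union> (((*) 3 ` thirds 1 \<union> (*) 3 ` thirds 2) \<union> ((*) 9 ` ninths 1 \<union> (*) 9 ` ninths 2))"
  proof
    fix x assume "x \<in> {x \<in> A. \<not> 27 dvd x}"
    then have x: "x \<in> A" "\<not> 27 dvd x" by auto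
    show "x \<in> (?N \<inter> A) \<union> (((*) 3 ` thirds 1 \<union> (*) 3 ` thirds 2) \<union> ((*) 9 ` ninths 1 \<union> (*) 9 ` ninths 2))"
    proof (cases "3 dvd x")
      case False
      then show ?thesis using x sub by auto
    next
      case True
      then obtain s where s: "x = 3 * s" by (auto elim: dvdE)
      show ?thesis
      proof (cases "3 dvd s")
        case False
        then have "s mod 3 = 1 \<or> s mod 3 = 2" by presburger
        then show ?thesis using s x by (auto simp: thirds_def)
      next
        case True
        then obtain t where t: "s = 3 * t" by (auto elim: dvdE)
        have "\<not> 3 dvd t"
        proof
          assume "3 dvd t"
          then have "27 dvd x" using s t by (auto elim!: dvdE)
          then show False using x by simp
        qed
        then have "t mod 3 = 1 \<or> t mod 3 = 2" by presburger
        then show ?thesis using s t x by (auto simp: ninths_def)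
      qed
    qed
  qed
  then have "card {x \<in> A. \<not> 27 dvd x} \<le> card ((?N \<inter> A) \<union> (((*) 3 ` thirds 1 \<union> (*) 3 ` thirds 2) \<union> ((*) 9 ` ninths 1 \<union> (*) 9 ` ninths 2)))"
    by (rule card_mono[rotated]) (auto simp: finites)
  also have "\<dots> \<le> card (?N \<inter> A) + ((card (thirds 1) + card (thirds 2)) + (card (ninths 1) + card (ninths 2)))"
    by (intro order_trans[OF card_Un_le] add_mono card_image_le finites order_refl)
  also have "\<dots> \<le> card (?N \<inter> A) + (card (gaps 1) + card (gaps 2))"
    using card_multiples_le_card_gaps[OF True] by simp
  also have "\<dots> = card ((?N \<inter> A) \<union> (gaps 1 \<union> gaps 2))"
    by (subst card_Un_disjoint; (subst card_Un_disjoint)?) (auto simp: finites, auto simp: gaps_def)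
  also have "\<dots> \<le> card ?N" by (intro card_mono) (auto simp: gaps_def)
  finally show ?thesis .
qed

end

section \<open>One layer for the equation \<open>x + 2 y = 4 z\<close>\<close>

text \<open>Let \<open>J\<close> and \<open>J'\<close> be the largest exponents with \<open>2 * 3 ^ J * k \<le> n\<close> and \<open>4 * 3 ^ J' * k \<le> n\<close>. They
  differ by at most one, and the predicate says that both exist and are equal. It is constant along
  \<open>k, 3 k, 9 k, \<dots>\<close> as long as the doubles of these numbers stay in \<open>{1..n}\<close>.\<close>

definition doubles_up :: "nat \<Rightarrow> nat \<Rightarrow> bool" where
  "doubles_up n k \<longleftrightarrow> (\<exists>j. 4 * 3 ^ j * k \<le> n \<and> n < 6 * 3 ^ j * k)"

text \<open>The odd representative of the clique that contains \<open>a\<close>. For odd \<open>k\<close>, the number \<open>4 k\<close> always belongs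
  to \<open>3 k\<close>. The number \<open>2 k\<close> is compatible with neither \<open>k\<close> nor \<open>3 k\<close> and may join either, but \<open>2 k\<close> and \<open>6 k\<close>
  are compatible with each other and must not both join \<open>3 k\<close>. So the choice has to be uniform along
  \<open>k, 3 k, 9 k, \<dots>\<close>, which gives cliques of the form \<open>{2 k, 3 k, 4 k}\<close> or \<open>{3 k, 4 k, 6 k}\<close>. The first
  form requires that \<open>2 k \<le> n\<close> always entails \<open>3 k \<le> n\<close>; the predicate \<open>doubles_up\<close> tells when it does.\<close>

definition clique_rep :: "nat \<Rightarrow> nat \<Rightarrow> nat" where
  "clique_rep n a = (if odd a then a else if 4 dvd a then 3 * (a div 4)
     else if doubles_up n (a div 2) then 3 * (a div 2) else a div 2)"

lemma clique_rep_simps: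
  assumes "odd k"
  shows "clique_rep n k = k" "clique_rep n (4 * k) = 3 * k"
    "clique_rep n (2 * k) = (if doubles_up n k then 3 * k else k)"
proof -
  have "\<not> 4 dvd 2 * k" using assms by presburger
  then show "clique_rep n (2 * k) = (if doubles_up n k then 3 * k else k)" by (simp add: clique_rep_def)
qed (use assms in \<open>simp_all add: clique_rep_def\<close>)

lemma doubles_up_triple:
  assumes "doubles_up n k" "6 * k \<le> n" shows "doubles_up n (3 * k)"
proof -
  obtain j where j: "4 * 3 ^ j * k \<le> n" "n < 6 * 3 ^ j * k" using assms by (auto simp: doubles_up_def)
  then have "j \<noteq> 0" using assms(2) by (intro notI) simp
  then obtain i where "j = Suc i" by (metis not0_implies_Suc)
  then show ?thesis using j by (auto simp: doubles_up_def ac_simps intro!: exI[of _ i])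
qed

lemma doubles_up_le: "doubles_up n k \<Longrightarrow> 4 * k \<le> n"
proof -
  assume "doubles_up n k"
  then obtain j where "4 * 3 ^ j * k \<le> n" by (auto simp: doubles_up_def)
  moreover have "4 * 1 * k \<le> 4 * 3 ^ j * k" by (intro mult_le_mono) auto
  ultimately show ?thesis by linarith
qed

lemma odd_decomp:
  fixes a :: nat assumes "\<not> 8 dvd a"
  obtains k where "odd k" "a = k \<or> a = 2 * k \<or> a = 4 * k"
proof (cases "odd a")
  case False
  then obtain b where b: "a = 2 * b" by (auto elim: evenE)
  show ?thesis
  proof (cases "odd b")
    case False
    then obtain c where c: "b = 2 * c" by (auto elim: evenE)
    have "odd c" using assms b c by (auto elim!: evenE)
    then show ?thesis using that[of c] b c by simp
  qed (use that[of b] b in simp)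
qed (use that[of a] in simp)

text \<open>Two elements of \<open>A\<close> never have the same representative, because their ratio would be \<open>2\<close>, \<open>3 / 2\<close>
  or \<open>4 / 3\<close>: with \<open>x = 2 t\<close>, \<open>y = z = t\<close>, or \<open>x = z = 2 t\<close>, \<open>y = 3 t\<close>, or \<open>x = y = 4 t\<close>, \<open>z = 3 t\<close>
  the equation \<open>x + 2 y = 4 z\<close> holds.\<close>

lemma card_not_dvd_8_le:
  fixes A :: "nat set"
  assumes sub: "A \<subseteq> {1..n}" and no: "\<And>x y z. \<lbrakk>x \<in> A; y \<in> A; z \<in> A\<rbrakk> \<Longrightarrow> x + 2 * y \<noteq> 4 * z"
  shows "card {x \<in> A. \<not> 8 dvd x} \<le> card {x \<in> {1..n}. \<not> 2 dvd x}"
proof -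
  have no12: "\<not> (t \<in> A \<and> 2 * t \<in> A)" for t using no[of "2 * t" t t] by auto
  have no23: "\<not> (2 * t \<in> A \<and> 3 * t \<in> A)" for t using no[of "2 * t" "3 * t" "2 * t"] by auto
  have no34: "\<not> (3 * t \<in> A \<and> 4 * t \<in> A)" for t using no[of "4 * t" "4 * t" "3 * t"] by auto
  have le: "a \<in> A \<Longrightarrow> 1 \<le> a \<and> a \<le> n" for a using sub by auto
  let ?S = "{x \<in> A. \<not> 8 dvd x}"
  have "clique_rep n ` ?S \<subseteq> {x \<in> {1..n}. \<not> 2 dvd x}"
  proof clarify
    fix a assume a: "a \<in> A" "\<not> 8 dvd a"
    obtain k where k: "odd k" "a = k \<or> a = 2 * k \<or> a = 4 * k" using odd_decomp[OF a(2)] .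
    then have "clique_rep n a = k \<and> k \<le> n \<or> clique_rep n a = 3 * k \<and> 3 * k \<le> n"
      using clique_rep_simps[OF k(1)] le[OF a(1)] doubles_up_le[of n k] by auto
    moreover have "1 \<le> k" using k(1) by (cases k) auto
    ultimately show "clique_rep n a \<in> {1..n} \<and> \<not> 2 dvd clique_rep n a" using k(1) by auto
  qed
  moreover have "inj_on (clique_rep n) ?S"
  proof -
    have main: "a = b"
      if ab: "a \<in> A" "b \<in> A" "clique_rep n a = clique_rep n b" and odd: "odd k" "odd l"
        and cases: "a = k \<and> (b = l \<or> b = 2 * l \<or> b = 4 * l) \<or> a = 2 * k \<and> (b = 2 * l \<or> b = 4 * l) \<or> a = 4 * k \<and> b = 4 * l"
      for a b k l
    proof -
      note rep = clique_rep_simps[OF odd(1), of n] clique_rep_simps[OF odd(2), of n]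
      \<comment> \<open>This keeps \<open>2 k\<close> and \<open>6 k\<close> from both joining \<open>3 k\<close>.\<close>
      have doubles: "doubles_up n l" if "doubles_up n k" "l = 3 * k" "2 * l \<le> n" for k l
        using doubles_up_triple[of n k] that by simp
      consider "a = k" "b = l" | "a = k" "b = 2 * l" | "a = k" "b = 4 * l"
        | "a = 2 * k" "b = 2 * l" | "a = 2 * k" "b = 4 * l" | "a = 4 * k" "b = 4 * l"
        using cases by blast
      then show ?thesis
      proof cases
        case 1
        then show ?thesis using ab rep by simp
      next
        case 2
        then have "k = (if doubles_up n l then 3 * l else l)" using ab rep by simp
        then show ?thesis using 2 ab no12[of l] no23[of l] by (auto split: if_splits)
      next
        case 3
        then have "k = 3 * l" using ab rep by simp
        then show ?thesis using 3 ab no34[of l] by auto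
      next
        case 4
        then have same: "(if doubles_up n k then 3 * k else k) = (if doubles_up n l then 3 * l else l)" using ab rep by simp
        have "2 * k \<le> n" "2 * l \<le> n" using le[OF ab(1)] le[OF ab(2)] 4 by simp_all
        then have "doubles_up n k \<longleftrightarrow> doubles_up n l"
          using same doubles[of k l] doubles[of l k] by metis
        then show ?thesis using 4 same by (simp split: if_splits)
      next
        case 5
        then have "(if doubles_up n k then 3 * k else k) = 3 * l" using ab rep by simp
        then have "k = l \<or> k = 3 * l" by (auto split: if_splits)
        then show ?thesis using 5 ab no12[of "2 * l"] no23[of "2 * l"] by auto
      next
        case 6
        then show ?thesis using ab rep by simp
      qed
    qed
    show ?thesis
    proof (rule inj_onI)
      fix a b assume a: "a \<in> ?S" and b: "b \<in> ?S" and eq: "clique_rep n a = clique_rep n b"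
      obtain k where k: "odd k" "a = k \<or> a = 2 * k \<or> a = 4 * k" using odd_decomp[of a] a by blast
      obtain l where l: "odd l" "b = l \<or> b = 2 * l \<or> b = 4 * l" using odd_decomp[of b] b by blast
      show "a = b" using main[of a b k l] main[of b a l k] a b eq k l by auto
    qed
  qed
  ultimately show ?thesis by (intro card_inj_on_le[of "clique_rep n"]) auto
qed

section \<open>Avoiding sets are no larger than \<open>A_b b\<close>\<close>

lemma avoiding_eqn_b_iff:
  "avoiding (eqn_b b) A \<longleftrightarrow> (\<forall>x\<in>A. \<forall>y\<in>A. \<forall>z\<in>A. x + b * y \<noteq> b\<^sup>2 * z)"
proof -
  have "solution (eqn_b b) x y z \<longleftrightarrow> x + b * y = b\<^sup>2 * z" for x y z
    unfolding eqn_b_def by (simp flip: of_nat_mult of_nat_add of_nat_power del: of_nat_add of_nat_mult of_nat_power)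
  then show ?thesis by (auto simp: avoiding_def)
qed

lemma card_peel:
  fixes c :: nat assumes "A \<subseteq> {1..n}" "0 < c"
  shows "card A = card {x \<in> A. \<not> c dvd x} + card {t. c * t \<in> A}"
proof -
  have fin: "finite A" using assms(1) finite_subset by blast
  have "A = {x \<in> A. \<not> c dvd x} \<union> (*) c ` {t. c * t \<in> A}" by (auto elim: dvdE)
  then have "card A = card ({x \<in> A. \<not> c dvd x} \<union> (*) c ` {t. c * t \<in> A})" by simp
  also have "\<dots> = card {x \<in> A. \<not> c dvd x} + card ((*) c ` {t. c * t \<in> A})"
    using fin by (intro card_Un_disjoint) (auto intro: finite_subset[of _ A])
  also have "card ((*) c ` {t. c * t \<in> A}) = card {t. c * t \<in> A}"
    using assms(2) by (intro card_image) (auto simp: inj_on_def)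
  finally show ?thesis .
qed

lemma A_b_iff_not_dvd:
  assumes "1 < b" "\<not> b ^ 3 dvd x"
  shows "x \<in> A_b b \<longleftrightarrow> \<not> b dvd x"
proof
  assume "x \<in> A_b b"
  then obtain u i where u: "x = u * b ^ (3 * i)" "\<not> b dvd u" by (auto simp: A_b_def)
  have "i = 0"
  proof (rule ccontr)
    assume "i \<noteq> 0"
    then have "b ^ 3 dvd b ^ (3 * i)" by (intro le_imp_power_dvd) simp
    then show False using u assms(2) by simp
  qed
  then show "\<not> b dvd x" using u by simp
next
  assume "\<not> b dvd x"
  moreover have "0 < x" using assms(2) by (cases x) auto
  moreover have "x = x * b ^ (3 * 0)" by simp
  ultimately show "x \<in> A_b b" unfolding A_b_def by blast
qed

lemma cube_mult_in_A_b_iff: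
  assumes "1 < b"
  shows "b ^ 3 * t \<in> A_b b \<longleftrightarrow> t \<in> A_b b"
proof
  assume "b ^ 3 * t \<in> A_b b"
  then obtain u i where u: "b ^ 3 * t = u * b ^ (3 * i)" "\<not> b dvd u" "0 < u" by (auto simp: A_b_def)
  have "i \<noteq> 0"
  proof
    assume "i = 0"
    then have "b ^ 3 dvd u" using u by (metis dvd_triv_left mult.right_neutral mult_0_right power_0)
    then show False using u(2) by (metis dvd_power dvd_trans zero_less_numeral)
  qed
  then obtain j where "i = Suc j" by (metis not0_implies_Suc)
  then have "b ^ 3 * t = b ^ 3 * (u * b ^ (3 * j))" using u by (simp add: power_add ac_simps)
  then have "t = u * b ^ (3 * j)" using assms by simp
  then show "t \<in> A_b b" using u by (auto simp: A_b_def)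
next
  assume "t \<in> A_b b"
  then obtain u i where u: "t = u * b ^ (3 * i)" "\<not> b dvd u" "0 < u" by (auto simp: A_b_def)
  then have "b ^ 3 * t = u * b ^ (3 * Suc i)" by (simp add: power_add ac_simps)
  then show "b ^ 3 * t \<in> A_b b" using u unfolding A_b_def by blast
qed

lemma card_A_b_rec:
  assumes "1 < b"
  shows "card (A_b b \<inter> {1..n}) = (n - n div b) + card (A_b b \<inter> {1..n div b ^ 3})"
proof -
  have "card (A_b b \<inter> {1..n}) =
      card {x \<in> A_b b \<inter> {1..n}. \<not> b ^ 3 dvd x} + card {t. b ^ 3 * t \<in> A_b b \<inter> {1..n}}"
    using assms by (intro card_peel[of _ n]) auto
  also have "{x \<in> A_b b \<inter> {1..n}. \<not> b ^ 3 dvd x} = {x \<in> {1..n}. \<not> b dvd x}"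
  proof -
    have "\<not> b dvd x \<Longrightarrow> \<not> b ^ 3 dvd x" for x by (metis dvd_power dvd_trans zero_less_numeral)
    then show ?thesis using A_b_iff_not_dvd[OF assms] by blast
  qed
  also have "{t. b ^ 3 * t \<in> A_b b \<inter> {1..n}} = A_b b \<inter> {1..n div b ^ 3}"
  proof -
    have "1 \<le> b ^ 3 * t \<and> b ^ 3 * t \<le> n \<longleftrightarrow> 1 \<le> t \<and> t \<le> n div b ^ 3" for t
      using assms by (auto simp: less_eq_div_iff_mult_less_eq mult.commute Suc_le_eq)
    then show ?thesis using cube_mult_in_A_b_iff[OF assms] by auto
  qed
  finally show ?thesis using card_not_dvd[of b n] assms by simp
qed

text \<open>Peeling off the elements outside the multiples of \<open>b ^ 3\<close> from \<open>A\<close> and from \<open>A_b b\<close> reduces \<open>n\<close> to \<open>n div b ^ 3\<close>.\<close>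

lemma card_le_card_A_b:
  assumes b: "b \<in> {2, 3}" and "A \<subseteq> {1..n}" "avoiding (eqn_b b) A"
  shows "card A \<le> card (A_b b \<inter> {1..n})"
  using assms(2,3)
proof (induction n arbitrary: A rule: less_induct)
  case (less n)
  have no: "x + b * y \<noteq> b\<^sup>2 * z" if "x \<in> A" "y \<in> A" "z \<in> A" for x y z
    using less.prems(2) that by (simp add: avoiding_eqn_b_iff)
  show ?case
  proof (cases "n = 0")
    case True
    then show ?thesis using less.prems by simp
  next
    case False
    have b1: "1 < b" using b by auto
    have layer: "card {x \<in> A. \<not> b ^ 3 dvd x} \<le> n - n div b"
    proof (cases "b = 2")
      case True
      then show ?thesis using card_not_dvd_8_le[OF less.prems(1)] no card_not_dvd[of 2 n] by simp
    next
      case False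
      then have b3: "b = 3" using b by simp
      interpret avoiding_3 n A using less.prems(1) no b3 by unfold_locales auto
      show ?thesis using card_not_dvd_27_le card_not_dvd[of 3 n] b3 by simp
    qed
    let ?B = "{t. b ^ 3 * t \<in> A}"
    have "?B \<subseteq> {1..n div b ^ 3}"
    proof
      fix t assume "t \<in> ?B"
      then have "1 \<le> b ^ 3 * t" "b ^ 3 * t \<le> n" using less.prems(1) by auto
      then show "t \<in> {1..n div b ^ 3}"
        using b1 by (auto simp: less_eq_div_iff_mult_less_eq mult.commute Suc_le_eq)
    qed
    moreover have "avoiding (eqn_b b) ?B"
    proof -
      have "b ^ 3 * x + b * (b ^ 3 * y) = b ^ 3 * (x + b * y)" "b\<^sup>2 * (b ^ 3 * z) = b ^ 3 * (b\<^sup>2 * z)" for x y z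
        by (simp_all add: algebra_simps)
      then show ?thesis unfolding avoiding_eqn_b_iff
        using no by (metis mem_Collect_eq)
    qed
    moreover have "n div b ^ 3 < n" using False b1 one_less_power[OF b1, of 3] by (intro div_less_dividend) auto
    ultimately have "card ?B \<le> card (A_b b \<inter> {1..n div b ^ 3})" using less.IH by blast
    moreover have "card A = card {x \<in> A. \<not> b ^ 3 dvd x} + card ?B"
      using less.prems(1) b1 by (intro card_peel[of _ n]) auto
    ultimately show ?thesis using layer card_A_b_rec[OF b1, of n] by linarith
  qed
qed

section \<open>The set \<open>A_b b\<close> avoids the equation, also modulo powers of \<open>b\<close>\<close>

text \<open>With \<open>x = u * b ^ (3 * i)\<close>, \<open>y = v * b ^ (3 * k)\<close>, \<open>z = w * b ^ (3 * l)\<close> the terms carry the exponents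
  \<open>3 * i\<close>, \<open>3 * k + 1\<close>, \<open>3 * l + 2\<close>, which are distinct and smaller than \<open>3 * j\<close>. Modulo the power of
  \<open>b\<close> just above the smallest exponent, only one term survives, and \<open>b\<close> would divide its cofactor.\<close>

lemma not_dvd_combination_A_b:
  assumes b: "1 < b" and mem: "x \<in> A_b b" "y \<in> A_b b" "z \<in> A_b b"
    and less: "x < b ^ (3 * j)" "y < b ^ (3 * j)" "z < b ^ (3 * j)"
  shows "\<not> int b ^ (3 * j) dvd int x + int b * int y - int b ^ 2 * int z"
proof
  assume dvd: "int b ^ (3 * j) dvd int x + int b * int y - int b ^ 2 * int z"
  have decomp: "\<exists>u i. x = u * b ^ (3 * i) \<and> \<not> b dvd u \<and> i < j" if x: "x \<in> A_b b" "x < b ^ (3 * j)" for x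
  proof -
    obtain u i where u: "x = u * b ^ (3 * i)" "\<not> b dvd u" "0 < u" using x by (auto simp: A_b_def)
    then have "1 * b ^ (3 * i) \<le> x" by (metis mult_le_mono1 Suc_leI One_nat_def)
    then have "b ^ (3 * i) < b ^ (3 * j)" using x by simp
    then have "3 * i < 3 * j" using power_less_imp_less_exp[OF b] by blast
    then have "i < j" by simp
    then show ?thesis using u by blast
  qed
  obtain u i where u: "x = u * b ^ (3 * i)" "\<not> b dvd u" "i < j" using decomp mem(1) less(1) by blast
  obtain v k where v: "y = v * b ^ (3 * k)" "\<not> b dvd v" "k < j" using decomp mem(2) less(2) by blast
  obtain w l where w: "z = w * b ^ (3 * l)" "\<not> b dvd w" "l < j" using decomp mem(3) less(3) by blast
  define B where "B = int b"
  have eq: "int x + int b * int y - int b ^ 2 * int z =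
      int u * B ^ (3 * i) + int v * B ^ (3 * k + 1) - int w * B ^ (3 * l + 2)"
    by (simp add: u v w B_def power_add algebra_simps power2_eq_square)
  have lowest: "b dvd u" if "B ^ Suc a dvd int u * B ^ a" for u a
  proof -
    have "B dvd int u" using that b by (simp add: B_def)
    then show ?thesis by (simp add: B_def)
  qed
  have dvd': "B ^ Suc a dvd int u * B ^ (3 * i) + int v * B ^ (3 * k + 1) - int w * B ^ (3 * l + 2)" if "a < 3 * j" for a
  proof -
    have "B ^ Suc a dvd int b ^ (3 * j)" unfolding B_def using that by (intro le_imp_power_dvd) simp
    then show ?thesis using dvd_trans dvd unfolding eq by blast
  qed
  have high: "B ^ Suc a dvd c * B ^ e" if "a < e" for a e c
    using that by (intro dvd_mult le_imp_power_dvd) simp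
  have "i \<le> k \<and> i \<le> l \<or> k < i \<and> k \<le> l \<or> l < i \<and> l < k" by arith
  then consider "i \<le> k" "i \<le> l" | "k < i" "k \<le> l" | "l < i" "l < k" by blast
  then show False
  proof cases
    case 1
    have "B ^ Suc (3 * i) dvd (int u * B ^ (3 * i) + int v * B ^ (3 * k + 1) - int w * B ^ (3 * l + 2))
        - int v * B ^ (3 * k + 1) + int w * B ^ (3 * l + 2)"
      using 1 u(3) by (intro dvd_add dvd_diff dvd' high) auto
    then show False using lowest[of "3 * i" u] u(2) by simp
  next
    case 2
    have "B ^ Suc (3 * k + 1) dvd (int u * B ^ (3 * i) + int v * B ^ (3 * k + 1) - int w * B ^ (3 * l + 2))
        - int u * B ^ (3 * i) + int w * B ^ (3 * l + 2)"
      using 2 v(3) by (intro dvd_add dvd_diff dvd' high) auto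
    then show False using lowest[of "3 * k + 1" v] v(2) by (simp add: algebra_simps)
  next
    case 3
    have "B ^ Suc (3 * l + 2) dvd int u * B ^ (3 * i) + int v * B ^ (3 * k + 1)
        - (int u * B ^ (3 * i) + int v * B ^ (3 * k + 1) - int w * B ^ (3 * l + 2))"
      using 3 w(3) by (intro dvd_add dvd_diff dvd' high) auto
    then show False using lowest[of "3 * l + 2" w] w(2) by (simp add: algebra_simps)
  qed
qed

lemma avoiding_mod_A_b:
  assumes "1 < b"
  shows "avoiding_mod (b ^ (3 * j)) (eqn_b b) (A_b b \<inter> {1..<b ^ (3 * j)})"
  using not_dvd_combination_A_b[OF assms, of _ _ _ j]
  by (auto simp: avoiding_mod_def eqn_b_def cong_iff_dvd_diff)

text \<open>A solution is in particular a solution modulo a power of \<open>b\<close> that exceeds \<open>x\<close>, \<open>y\<close> and \<open>z\<close>.\<close>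

lemma avoiding_A_b:
  assumes "1 < b"
  shows "avoiding (eqn_b b) (A_b b)"
  unfolding avoiding_eqn_b_iff
proof (intro ballI notI)
  fix x y z assume mem: "x \<in> A_b b" "y \<in> A_b b" "z \<in> A_b b" and eq: "x + b * y = b\<^sup>2 * z"
  let ?j = "x + y + z"
  have "?j < b ^ ?j" using assms by (simp add: power_gt_expt)
  also have "\<dots> \<le> b ^ (3 * ?j)" using assms by (intro power_increasing) auto
  finally have "?j < b ^ (3 * ?j)" .
  then have "\<not> int b ^ (3 * ?j) dvd int x + int b * int y - int b ^ 2 * int z"
    using not_dvd_combination_A_b[OF assms mem, of ?j] by linarith
  moreover have "int x + int b * int y - int b ^ 2 * int z = 0"
    using arg_cong[OF eq, of int] by simp
  ultimately show False by simp
qed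

lemma max_avoiding_eq:
  assumes "b \<in> {2, 3}"
  shows "max_avoiding (eqn_b b) n = card (A_b b \<inter> {1..n})"
  unfolding max_avoiding_def
proof (rule Max_eqI)
  have "{card A |A. A \<subseteq> {1..n} \<and> avoiding (eqn_b b) A} \<subseteq> card ` Pow {1..n}" by auto
  then show "finite {card A |A. A \<subseteq> {1..n} \<and> avoiding (eqn_b b) A}" by (rule finite_subset) simp
  show "k \<le> card (A_b b \<inter> {1..n})" if "k \<in> {card A |A. A \<subseteq> {1..n} \<and> avoiding (eqn_b b) A}" for k
    using that card_le_card_A_b[OF assms] by auto
  have "1 < b" using assms by auto
  then have "avoiding (eqn_b b) (A_b b \<inter> {1..n})" using avoiding_A_b by (auto simp: avoiding_def)
  then show "card (A_b b \<inter> {1..n}) \<in> {card A |A. A \<subseteq> {1..n} \<and> avoiding (eqn_b b) A}" by blast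
qed

section \<open>Densities\<close>

lemma real_div_bounds:
  fixes n c :: nat assumes "0 < c"
  shows "real (n div c) \<le> real n / real c" "real n / real c \<le> real (n div c) + 1"
proof -
  have "real n = real c * real (n div c) + real (n mod c)"
    by (metis mult_div_mod_eq of_nat_add of_nat_mult)
  then have "real n / real c = real (n div c) + real (n mod c) / real c"
    using assms by (simp add: add_divide_distrib)
  moreover have "0 \<le> real (n mod c) / real c" "real (n mod c) / real c \<le> 1" using assms by simp_all
  ultimately show "real (n div c) \<le> real n / real c" "real n / real c \<le> real (n div c) + 1" by linarith+
qed

text \<open>The density \<open>\<rho>\<close> is the fixed point of \<open>\<rho> = 1 - 1 / b + \<rho> / b ^ 3\<close>, the limit form of the recursion
  for the cardinality. One step of the recursion costs a rounding error of at most \<open>2\<close>, and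
  \<open>5 * sqrt n\<close> absorbs it since the argument shrinks at least by the factor \<open>4\<close>.\<close>

lemma card_A_b_approx:
  assumes b: "1 < b"
  defines "\<rho> \<equiv> real b ^ 2 / (real b ^ 2 + real b + 1)"
  shows "\<bar>real (card (A_b b \<inter> {1..n})) - \<rho> * real n\<bar> \<le> 5 * sqrt (real n)"
proof (induction n rule: less_induct)
  case (less n)
  show ?case
  proof (cases "n = 0")
    case True
    then show ?thesis by simp
  next
    case False
    define c where "c = b ^ 3"
    have c8: "8 \<le> c" using power_mono[of 2 b 3] b by (simp add: c_def)
    then have c0: "0 < c" by simp
    define m where "m = n div c"
    have "m < n" using False c8 by (auto simp: m_def intro!: div_less_dividend)
    then have IH: "\<bar>real (card (A_b b \<inter> {1..m})) - \<rho> * real m\<bar> \<le> 5 * sqrt (real m)" by (rule less.IH)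
    have "real m \<le> real n / real c" unfolding m_def by (rule real_div_bounds(1)[OF c0])
    also have "\<dots> \<le> real n / 4" using c8 by (intro frac_le) auto
    finally have "sqrt (real m) \<le> sqrt (real n / 4)" by simp
    then have sqrt_m: "sqrt (real m) \<le> sqrt (real n) / 2" by (simp add: real_sqrt_divide)
    have sqrt_n: "1 \<le> sqrt (real n)" using False by simp
    have den: "0 < real b ^ 2 + real b + 1" using b by (simp add: add_pos_pos)
    have \<rho>: "0 \<le> \<rho>" "\<rho> \<le> 1" using b den by (simp_all add: \<rho>_def)
    have \<rho>_rec: "\<rho> = 1 - 1 / real b + \<rho> / real c"
      using b den by (simp add: \<rho>_def c_def divide_simps) algebra
    have d1: "\<bar>real (n div b) - real n / real b\<bar> \<le> 1"
      using real_div_bounds[of b n] b by simp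
    have d3: "\<bar>real m - real n / real c\<bar> \<le> 1"
      unfolding m_def using real_div_bounds[OF c0, of n] by simp
    have "\<bar>\<rho> * (real m - real n / real c)\<bar> \<le> 1 * 1"
      unfolding abs_mult using \<rho> d3 by (intro mult_mono) auto
    then have d4: "\<bar>\<rho> * real m - \<rho> * (real n / real c)\<bar> \<le> 1"
      by (simp only: right_diff_distrib mult_1_right)
    have "card (A_b b \<inter> {1..n}) = (n - n div b) + card (A_b b \<inter> {1..m})"
      unfolding m_def c_def by (rule card_A_b_rec[OF b])
    then have "real (card (A_b b \<inter> {1..n})) = real (n - n div b) + real (card (A_b b \<inter> {1..m}))"
      by (metis of_nat_add)
    moreover have "real (n - n div b) = real n - real (n div b)" by (rule of_nat_diff) (rule div_le_dividend)
    moreover have "\<rho> * real n = real n - real n / real b + \<rho> * (real n / real c)"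
      by (subst \<rho>_rec) (simp add: algebra_simps)
    ultimately have "\<bar>real (card (A_b b \<inter> {1..n})) - \<rho> * real n\<bar> \<le>
        \<bar>real (card (A_b b \<inter> {1..m})) - \<rho> * real m\<bar> + 2"
      using d1 d4 by linarith
    then show ?thesis using IH sqrt_m sqrt_n by linarith
  qed
qed

lemma card_A_b_density:
  assumes b: "1 < b"
  shows "(\<lambda>n. real (card (A_b b \<inter> {1..n})) / real n) \<longlonglongrightarrow> real b ^ 2 / (real b ^ 2 + real b + 1)"
proof -
  define \<rho> where "\<rho> = real b ^ 2 / (real b ^ 2 + real b + 1)"
  have "(\<lambda>n. real (card (A_b b \<inter> {1..n})) / real n - \<rho>) \<longlonglongrightarrow> 0"
  proof (rule tendsto_0_le)
    show "\<forall>\<^sub>F n in sequentially. norm (real (card (A_b b \<inter> {1..n})) / real n - \<rho>) \<le> norm (5 / sqrt (real n)) * 1"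
    proof (rule eventually_sequentiallyI[of 1])
      fix n :: nat assume n: "1 \<le> n"
      have "norm (real (card (A_b b \<inter> {1..n})) / real n - \<rho>) = \<bar>real (card (A_b b \<inter> {1..n})) - \<rho> * real n\<bar> / real n"
      proof -
        have "real (card (A_b b \<inter> {1..n})) / real n - \<rho> = (real (card (A_b b \<inter> {1..n})) - \<rho> * real n) / real n"
          using n by (simp add: diff_divide_distrib)
        then show ?thesis by (simp add: abs_divide)
      qed
      also have "\<dots> \<le> 5 * sqrt (real n) / real n"
        using card_A_b_approx[OF b, of n] by (intro divide_right_mono) (simp_all add: \<rho>_def)
      also have "\<dots> = 5 / sqrt (real n)" using n by (simp add: real_div_sqrt divide_simps)
      finally show "norm (real (card (A_b b \<inter> {1..n})) / real n - \<rho>) \<le> norm (5 / sqrt (real n)) * 1" by simp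
    qed
    have "filterlim (\<lambda>n. sqrt (real n)) at_top sequentially"
      by (rule filterlim_compose[OF sqrt_at_top filterlim_real_sequentially])
    then show "(\<lambda>n. 5 / sqrt (real n)) \<longlonglongrightarrow> 0"
      by (intro real_tendsto_divide_at_top[OF tendsto_const])
  qed
  then show ?thesis unfolding \<rho>_def[symmetric] by (simp add: LIM_zero_iff)
qed

lemma finite_card_avoiding_mod: "finite {card A | A. A \<subseteq> {1..m} \<and> avoiding_mod m L A}"
  by (rule finite_subset[of _ "card ` Pow {1..m}"]) auto

lemma rho_mod_attained:
  "\<exists>B \<subseteq> {1..m}. avoiding_mod m L B \<and> rho_mod L m = real (card B) / real m"
proof -
  have "avoiding_mod m L {}" by (simp add: avoiding_mod_def)
  then have "{card A | A. A \<subseteq> {1..m} \<and> avoiding_mod m L A} \<noteq> {}" by blast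
  from Max_in[OF finite_card_avoiding_mod this] show ?thesis by (auto simp: rho_mod_def)
qed

lemma rho_mod_ge:
  assumes "C \<subseteq> {1..m}" "avoiding_mod m L C"
  shows "real (card C) / real m \<le> rho_mod L m"
proof -
  have "card C \<le> Max {card A | A. A \<subseteq> {1..m} \<and> avoiding_mod m L A}"
    using assms by (intro Max_ge finite_card_avoiding_mod) blast
  then show ?thesis unfolding rho_mod_def by (intro divide_right_mono) auto
qed

lemma card_periodic_extension:
  fixes B :: "nat set" and k m :: nat
  assumes "B \<subseteq> {1..m}"
  defines "C \<equiv> (\<lambda>(i, x). x + i * m) ` ({..<k} \<times> B)"
  shows "C \<subseteq> {1..k * m}" "card C = k * card B"
proof -
  show "C \<subseteq> {1..k * m}"
  proof
    fix y assume "y \<in> C"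
    then obtain i x where ix: "i < k" "x \<in> B" "y = x + i * m" by (auto simp: C_def)
    then have "1 \<le> x" "x \<le> m" using assms(1) by auto
    moreover have "Suc i * m \<le> k * m" using ix(1) by (intro mult_le_mono1) simp
    ultimately show "y \<in> {1..k * m}" using ix(3) by simp
  qed
  have "inj_on (\<lambda>(i, x). x + i * m) ({..<k} \<times> B)"
  proof (rule inj_onI, clarify)
    fix i x j y assume xy: "x \<in> B" "y \<in> B" "x + i * m = y + j * m"
    then have "1 \<le> x" "x \<le> m" "1 \<le> y" "y \<le> m" using assms(1) by auto
    then have less: "x - 1 < m" "y - 1 < m" "m \<noteq> 0" by linarith+
    then have "((x - 1) + i * m) div m = i" "((y - 1) + j * m) div m = j"
      using div_mult_self1[of m "x - 1" i] div_mult_self1[of m "y - 1" j] by (metis add.right_neutral div_less)+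
    moreover have "(x - 1) + i * m = (y - 1) + j * m" using xy \<open>1 \<le> x\<close> \<open>1 \<le> y\<close> by linarith
    ultimately have "i = j" by metis
    then show "i = j \<and> x = y" using xy by simp
  qed
  then show "card C = k * card B" unfolding C_def by (simp add: card_image card_cartesian_product)
qed

lemma avoiding_periodic_extension:
  assumes "avoiding_mod m L B"
  shows "avoiding L ((\<lambda>(i, x). x + i * m) ` ({..<k} \<times> B))"
proof -
  obtain p q r where L: "L = Lin_Eq p q r" using lin_eq.exhaust by blast
  have "solution_mod m L x y z"
    if "solution L (x + i * m) (y + j * m) (z + l * m)" for x y z i j l
  proof -
    have shift: "[int (w + s * m) = int w] (mod int m)" for w s by (simp add: cong_def)
    have "[p * int x + q * int y = p * int (x + i * m) + q * int (y + j * m)] (mod int m)"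
      by (intro cong_add cong_mult cong_refl cong_sym[OF shift])
    also have "p * int (x + i * m) + q * int (y + j * m) = r * int (z + l * m)" using that by (simp add: L)
    also have "[\<dots> = r * int z] (mod int m)" by (intro cong_mult cong_refl shift)
    finally show ?thesis by (simp add: L)
  qed
  then show ?thesis using assms unfolding avoiding_def avoiding_mod_def by fast
qed

text \<open>The periodic extension of a solution-free set modulo \<open>m\<close> to \<open>{1..k * m}\<close> is an avoiding set, so
  its density is at most that of \<open>A_b b \<inter> {1..k * m}\<close>, which tends to the right-hand side.\<close>

lemma rho_mod_le:
  assumes b: "b \<in> {2, 3}" and m: "0 < m"
  shows "rho_mod (eqn_b b) m \<le> real b ^ 2 / (real b ^ 2 + real b + 1)"
proof -
  obtain B where B: "B \<subseteq> {1..m}" "avoiding_mod m (eqn_b b) B" "rho_mod (eqn_b b) m = real (card B) / real m"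
    using rho_mod_attained by blast
  have "1 < b" using b by auto
  have "strict_mono (\<lambda>k. Suc k * m)" using m by (simp add: strict_mono_Suc_iff)
  then have lim: "(\<lambda>k. real (card (A_b b \<inter> {1..Suc k * m})) / real (Suc k * m))
      \<longlonglongrightarrow> real b ^ 2 / (real b ^ 2 + real b + 1)"
    using LIMSEQ_subseq_LIMSEQ[OF card_A_b_density[OF \<open>1 < b\<close>], of "\<lambda>k. Suc k * m"] unfolding comp_def by blast
  have "rho_mod (eqn_b b) m \<le> real (card (A_b b \<inter> {1..Suc k * m})) / real (Suc k * m)" for k
  proof -
    have "Suc k * card B \<le> card (A_b b \<inter> {1..Suc k * m})"
      using card_le_card_A_b[OF b, OF card_periodic_extension(1)[OF B(1)] avoiding_periodic_extension[OF B(2)]]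
        card_periodic_extension(2)[OF B(1), of "Suc k"] by metis
    then have "real (Suc k) * real (card B) \<le> real (card (A_b b \<inter> {1..Suc k * m}))"
      by (metis of_nat_mult of_nat_le_iff)
    then have "real (Suc k) * real (card B) / real (Suc k * m) \<le> real (card (A_b b \<inter> {1..Suc k * m})) / real (Suc k * m)"
      by (intro divide_right_mono) auto
    moreover have "real (Suc k) * real (card B) / real (Suc k * m) = real (card B) / real m"
      unfolding of_nat_mult by (rule mult_divide_mult_cancel_left) simp
    ultimately show ?thesis using B(3) by simp
  qed
  then show ?thesis by (intro LIMSEQ_le_const[OF lim]) auto
qed

text \<open>The number \<open>b ^ (3 * j)\<close> itself lies in \<open>A_b b\<close> and is \<open>0\<close> modulo \<open>b ^ (3 * j)\<close>, so it has to be left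
  out; this accounts for the \<open>- 1\<close>.\<close>

lemma rho_mod_power_ge:
  assumes b: "1 < b"
  shows "(real (card (A_b b \<inter> {1..b ^ (3 * j)})) - 1) / real (b ^ (3 * j)) \<le> rho_mod (eqn_b b) (b ^ (3 * j))"
proof -
  let ?m = "b ^ (3 * j)"
  have "card (A_b b \<inter> {1..?m}) \<le> card (insert ?m (A_b b \<inter> {1..<?m}))" by (intro card_mono) auto
  moreover have "card (insert ?m (A_b b \<inter> {1..<?m})) \<le> card (A_b b \<inter> {1..<?m}) + 1" by (simp add: card_insert_if)
  ultimately have "real (card (A_b b \<inter> {1..?m})) - 1 \<le> real (card (A_b b \<inter> {1..<?m}))" by linarith
  then have "(real (card (A_b b \<inter> {1..?m})) - 1) / real ?m \<le> real (card (A_b b \<inter> {1..<?m})) / real ?m"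
    by (intro divide_right_mono) auto
  also have "\<dots> \<le> rho_mod (eqn_b b) ?m" by (rule rho_mod_ge[OF _ avoiding_mod_A_b[OF b]]) auto
  finally show ?thesis .
qed

lemma rho_eqn_b:
  assumes b: "b \<in> {2, 3}"
  shows "rho (eqn_b b) = ereal (real b ^ 2 / (real b ^ 2 + real b + 1))" (is "_ = ereal ?\<rho>")
proof (rule antisym)
  show "rho (eqn_b b) \<le> ereal ?\<rho>"
    unfolding rho_def using rho_mod_le[OF b] by (intro SUP_least) auto
  have b1: "1 < b" using b by auto
  have mono: "strict_mono (\<lambda>j. b ^ (3 * j))" using b1 by (intro strict_monoI power_strict_increasing) auto
  have "(\<lambda>j. real (card (A_b b \<inter> {1..b ^ (3 * j)})) / real (b ^ (3 * j))) \<longlonglongrightarrow> ?\<rho>"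
    using LIMSEQ_subseq_LIMSEQ[OF card_A_b_density[OF b1] mono] by (simp add: comp_def)
  moreover have "(\<lambda>j. 1 / real (b ^ (3 * j))) \<longlonglongrightarrow> 0"
    using LIMSEQ_subseq_LIMSEQ[OF lim_1_over_n mono] by (simp add: comp_def)
  ultimately have "(\<lambda>j. real (card (A_b b \<inter> {1..b ^ (3 * j)})) / real (b ^ (3 * j)) - 1 / real (b ^ (3 * j))) \<longlonglongrightarrow> ?\<rho> - 0"
    by (rule tendsto_diff)
  then have "(\<lambda>j. (real (card (A_b b \<inter> {1..b ^ (3 * j)})) - 1) / real (b ^ (3 * j))) \<longlonglongrightarrow> ?\<rho>"
    by (simp add: diff_divide_distrib)
  then have lim: "(\<lambda>j. ereal ((real (card (A_b b \<inter> {1..b ^ (3 * j)})) - 1) / real (b ^ (3 * j)))) \<longlonglongrightarrow> ereal ?\<rho>"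
    by (rule tendsto_ereal)
  have "ereal ((real (card (A_b b \<inter> {1..b ^ (3 * j)})) - 1) / real (b ^ (3 * j))) \<le> rho (eqn_b b)" for j
  proof -
    have "ereal (rho_mod (eqn_b b) (b ^ (3 * j))) \<le> rho (eqn_b b)"
      unfolding rho_def using b1 by (intro SUP_upper) simp
    then show ?thesis using rho_mod_power_ge[OF b1, of j] by (meson ereal_less_eq(3) order_trans)
  qed
  then show "ereal ?\<rho> \<le> rho (eqn_b b)" by (intro LIMSEQ_le_const2[OF lim]) auto
qed

theorem theorem2p8:
  fixes b :: nat
  assumes "b \<in> {2, 3}"
  shows "(\<forall>n>0. avoiding (eqn_b b) (A_b b \<inter> {1..n})
            \<and> card (A_b b \<inter> {1..n}) = max_avoiding (eqn_b b) n)
       \<and> lambda0 (eqn_b b) = rho (eqn_b b)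
       \<and> rho (eqn_b b) = ereal (real b ^ 2 / (real b ^ 2 + real b + 1))"
proof (intro conjI allI impI)
  have b1: "1 < b" using assms by auto
  show "avoiding (eqn_b b) (A_b b \<inter> {1..n})" for n using avoiding_A_b[OF b1] by (auto simp: avoiding_def)
  show "card (A_b b \<inter> {1..n}) = max_avoiding (eqn_b b) n" for n using max_avoiding_eq[OF assms] by simp
  show rho: "rho (eqn_b b) = ereal (real b ^ 2 / (real b ^ 2 + real b + 1))" by (rule rho_eqn_b[OF assms])
  have "(\<lambda>n. ereal (real (max_avoiding (eqn_b b) n) / real n)) \<longlonglongrightarrow> ereal (real b ^ 2 / (real b ^ 2 + real b + 1))"
    using tendsto_ereal[OF card_A_b_density[OF b1]] by (simp add: max_avoiding_eq[OF assms])
  then have "lambda0 (eqn_b b) = ereal (real b ^ 2 / (real b ^ 2 + real b + 1))"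
    unfolding lambda0_def by (intro lim_imp_Limsup) auto
  then show "lambda0 (eqn_b b) = rho (eqn_b b)" using rho by simp
qed

end
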